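(* Let $f:\mathbb{R}^d\to\mathbb{R}$ be convex and let $\pi^X\propto\exp(-f)$ be the corresponding (log-concave) target probability distribution on $\mathbb{R}^d$. Let $\eta>0$ and let $\rho_k^X$ be the law of the $k$-th iterate $x_k$ of the proximal sampler with target $\pi^X$ and step size $\eta$, started from an initial distribution $\rho_0^X$. Then for every integer $k\ge 1$, $$H_{\pi^X}(\rho_k^X)\le \frac{W_2^2(\rho_0^X,\pi^X)}{k\eta}.$$
   Context: Probability measures are identified with their Lebesgue densities when these exist. The target $\pi^X\propto \exp(-f)$ on $\mathbb{R}^d$ is assumed to have finite second moment. Proximal sampler with step size $\eta>0$: define the joint probability density on $\mathbb{R}^d\times\mathbb{R}^d$ by $\pi(x,y)\propto \exp(-f(x)-\frac{1}{2\eta}\|x-y\|^2)$. Its conditionals are $\pi^{Y\mid X}(\cdot\mid x)=\mathcal N(x,\eta I)$ and $\pi^{X\mid Y}(x\mid y)\propto_x \exp(-f(x)-\frac1{2\eta}\|x-y\|^2)$, and its $X$-marginal is $\pi^X$. Starting from $x_0\sim\rho_0^X$, for $k=0,1,2,\dots$: draw $y_k\mid x_k\sim\pi^{Y\mid X}(\cdot\mid x_k)$, then draw $x_{k+1}\mid y_k\sim \pi^{X\mid Y}(\cdot\mid y_k)$ (exactly). $\rho_k^X$ denotes the law of $x_k$. KL divergence: $H_\pi(\rho)=\int\rho\log\frac{\rho}{\pi}$ for $\rho\ll\pi$. 2-Wasserstein distance: $W_2^2(\rho,\pi)=\inf_\gamma\int\|x-y\|^2\,d\gamma(x,y)$, the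 infimum being over all couplings $\gamma$ of $\rho$ and $\pi$. *)

theory Defs
  imports "HOL-Probability.Probability"
begin

definition normalized_measure :: "('a::euclidean_space \<Rightarrow> real) \<Rightarrow> 'a measure" where
  "normalized_measure g = density lborel (\<lambda>x. ennreal (g x / (LINT z|lborel. g z)))"

definition target :: "('a::euclidean_space \<Rightarrow> real) \<Rightarrow> 'a measure" where
  "target f = normalized_measure (\<lambda>x. exp (- f x))"

text \<open>Unnormalized density of the augmented target on pairs \<open>(x, y)\<close>.\<close>

definition joint_weight :: "('a::euclidean_space \<Rightarrow> real) \<Rightarrow> real \<Rightarrow> 'a \<Rightarrow> 'a \<Rightarrow> real" where
  "joint_weight f \<eta> x y = exp (- f x - (norm (x - y))\<^sup>2 / (2 * \<eta>))"

text \<open>The two conditionals of the augmented target. The law of \<open>y\<close> given \<open>x\<close> is the Gaussian with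
  mean \<open>x\<close> and covariance \<open>\<eta>\<close> times the identity.\<close>

definition gaussian :: "'a::euclidean_space \<Rightarrow> real \<Rightarrow> 'a measure" where
  "gaussian x \<eta> = density lborel
     (\<lambda>y. ennreal (exp (- (norm (y - x))\<^sup>2 / (2 * \<eta>)) / sqrt (2 * pi * \<eta>) ^ DIM('a)))"

definition cond_Y_given_X :: "real \<Rightarrow> 'a::euclidean_space \<Rightarrow> 'a measure" where
  "cond_Y_given_X \<eta> x = gaussian x \<eta>"

definition cond_X_given_Y :: "('a::euclidean_space \<Rightarrow> real) \<Rightarrow> real \<Rightarrow> 'a \<Rightarrow> 'a measure" where
  "cond_X_given_Y f \<eta> y = normalized_measure (\<lambda>x. joint_weight f \<eta> x y)"

text \<open>The law of the \<open>k\<close>-th iterate. Both kernels are composed with the bind of the Giry monad.\<close>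

primrec prox_law ::
  "('a::euclidean_space \<Rightarrow> real) \<Rightarrow> real \<Rightarrow> 'a measure \<Rightarrow> nat \<Rightarrow> 'a measure" where
  "prox_law f \<eta> \<rho>0 0 = \<rho>0"
| "prox_law f \<eta> \<rho>0 (Suc k) =
     (prox_law f \<eta> \<rho>0 k \<bind> cond_Y_given_X \<eta>) \<bind> cond_X_given_Y f \<eta>"

text \<open>The library's \<^const>\<open>KL_divergence\<close> is real-valued, and is \<open>0\<close> when the log-density is not
  integrable. For probability measures the negative part of the log-density is always
  \<open>\<rho>\<close>-integrable, so non-integrability means that the divergence is \<open>\<infinity>\<close>. Note the argument order:
  \<open>KL_divergence b \<pi> \<rho>\<close> integrates the logarithm of the density of \<open>\<rho>\<close> relative to \<open>\<pi>\<close>,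
  against \<open>\<rho>\<close>. Base \<open>exp 1\<close> gives the natural logarithm.\<close>

definition KL :: "'a measure \<Rightarrow> 'a measure \<Rightarrow> ereal" where
  "KL \<pi> \<rho> =
     (if absolutely_continuous \<pi> \<rho> \<and> integrable \<rho> (entropy_density (exp 1) \<pi> \<rho>)
      then ereal (KL_divergence (exp 1) \<pi> \<rho>) else \<infinity>)"

definition couplings ::
  "'a::euclidean_space measure \<Rightarrow> 'a measure \<Rightarrow> ('a \<times> 'a) measure set" where
  "couplings \<mu> \<nu> = {\<gamma>. sets \<gamma> = sets (borel \<Otimes>\<^sub>M borel) \<and>
     distr \<gamma> borel fst = \<mu> \<and> distr \<gamma> borel snd = \<nu>}"

definition W2_sq :: "'a::euclidean_space measure \<Rightarrow> 'a measure \<Rightarrow> ennreal" where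
  "W2_sq \<mu> \<nu> = (INF \<gamma>\<in>couplings \<mu> \<nu>. \<integral>\<^sup>+ (x, y). ennreal ((norm (x - y))\<^sup>2) \<partial>\<gamma>)"

end

theory Submission
  imports Defs
begin

text \<open>
  Let \<open>P\<close> be the Markov operator of one step of the sampler: a Gaussian forward step \<open>x \<mapsto> y\<close>,
  followed by a backward step that draws from \<open>Q y\<close>, the conditional law of \<open>x\<close> given \<open>y\<close>. The rate
  rests on a dimension-free log-Harnack inequality (\<open>log_harnack\<close>): for \<open>g \<ge> 1\<close> bounded and \<open>n \<ge> 1\<close>,
  \<open>P\<^sup>n (ln g) x \<le> ln (P\<^sup>n g x') + \<parallel>x - x'\<parallel>\<^sup>2 / (2 n \<eta>)\<close>.
  It says, in dual form, that the relative entropy between the \<open>n\<close>-step laws started at \<open>x\<close> and at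
  \<open>x'\<close> is at most \<open>\<parallel>x - x'\<parallel>\<^sup>2 / (2 n \<eta>)\<close>. Integrating it against a coupling of the initial law and
  the target, and using that the target is stationary, gives
  \<open>\<integral> ln g d\<rho>\<^sub>n \<le> ln (\<integral> g d\<pi>) + cost / (2 n \<eta>)\<close> for all such \<open>g\<close>. The Donsker--Varadhan formula
  (\<open>KL_le_of_dual_bound\<close>) turns this into a bound on the relative entropy, which is twice as strong
  as the claimed one.

  The log-Harnack inequality is proved by induction on \<open>n\<close>, by letting a third chain move gradually
  from one starting point to the other. Two facts drive the induction. In the Gaussian step,
  displacing the centre by \<open>d\<close> costs relative entropy \<open>\<parallel>d\<parallel>\<^sup>2 / (2 \<eta>)\<close> (\<open>gaussian_log_harnack\<close>).
  The backward step is non-expansive in the 2-Wasserstein distance, which is what convexity of \<open>f\<close> is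
  for (\<open>Q_contraction\<close>, stated in Kantorovich dual form so that no optimal coupling has to be chosen
  measurably). Closing the fraction \<open>1 / (n + 1)\<close> of the remaining gap by a displacement, and leaving
  the rest to the induction hypothesis, makes the constants add up to \<open>1 / (2 (n + 1) \<eta>)\<close>.

  Non-expansiveness is the composition of two inequalities with matching constants: the quadratic
  transport inequality for the \<open>1/\<eta>\<close>-strongly log-concave law \<open>Q y'\<close>, in Maurey's exponential form
  (\<open>exponential_transport\<close>), and the entropy bound \<open>KL (Q y') (Q y) \<le> \<parallel>y - y'\<parallel>\<^sup>2 / (2 \<eta>)\<close>
  (\<open>change_of_center\<close>), which expresses that the normalizing constant \<open>Z\<close> is log-concave. Both are
  consequences of the Prekopa--Leindler inequality, which is therefore proved first: in dimension one
  by integrating a Brunn--Minkowski inequality over level sets, then by induction on the dimension.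
\<close>

section \<open>The Prekopa--Leindler inequality\<close>

lemma nn_integral_layer_cake:
  fixes h :: "real \<Rightarrow> ennreal"
  assumes [measurable]: "h \<in> borel_measurable borel"
  shows "(\<integral>\<^sup>+x. h x \<partial>lborel) = 
    (\<integral>\<^sup>+t. indicator {0<..} t * emeasure lborel {x. ennreal t < h x} \<partial>lborel)"
proof -
  have level: "(\<integral>\<^sup>+t. indicator {t. 0 < t \<and> ennreal t < c} t \<partial>lborel) = c" for c :: ennreal
  proof (cases c)
    case (real r)
    then have "{t. 0 < t \<and> ennreal t < c} = {0<..<r}"
      by (auto simp: ennreal_less_iff)
    with real show ?thesis by simp
  next
    case top
    then have "{t. 0 < t \<and> ennreal t < c} = {0<..}" by auto
    then have "(\<integral>\<^sup>+t. indicator {t. 0 < t \<and> ennreal t < c} t \<partial>lborel) = emeasure lborel {0::real<..}"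
      by simp
    also have "\<dots> = \<infinity>" 
    proof -
      have "ennreal n \<le> emeasure lborel {0::real<..}" for n :: nat
      proof -
        have "emeasure lborel {0<..real n} \<le> emeasure lborel {0::real<..}"
          by (intro emeasure_mono) auto
        then show ?thesis by simp
      qed
      then have "(SUP n. of_nat n :: ennreal) \<le> emeasure lborel {0::real<..}"
        by (intro SUP_least) (simp add: ennreal_of_nat_eq_real_of_nat)
      then show ?thesis
        by (simp add: ennreal_SUP_of_nat_eq_top top.extremum_unique)
    qed
    finally show ?thesis using top by simp
  qed
  have "(\<integral>\<^sup>+x. h x \<partial>lborel) = (\<integral>\<^sup>+x. \<integral>\<^sup>+t. indicator {t. 0 < t \<and> ennreal t < h x} t \<partial>lborel \<partial>lborel)"
    by (simp add: level)
  also have "\<dots> = (\<integral>\<^sup>+t. \<integral>\<^sup>+x. indicator {t. 0 < t \<and> ennreal t < h x} t \<partial>lborel \<partial>lborel)"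
    by (rule lborel_pair.Fubini') measurable
  also have "\<dots> = (\<integral>\<^sup>+t. \<integral>\<^sup>+x. indicator {0<..} t * indicator {x. ennreal t < h x} x \<partial>lborel \<partial>lborel)"
    by (intro nn_integral_cong) (auto simp: indicator_def)
  also have "\<dots> = (\<integral>\<^sup>+t. indicator {0<..} t * emeasure lborel {x. ennreal t < h x} \<partial>lborel)"
    by (intro nn_integral_cong) (auto simp: nn_integral_cmult)
  finally show ?thesis .
qed

lemma emeasure_lborel_affine_vimage:
  fixes A :: "real set"
  assumes "A \<in> sets borel" "c > 0"
  shows "emeasure lborel {x. (x - t) / c \<in> A} = ennreal c * emeasure lborel A"
proof -
  have [measurable]: "{x. (x - t) / c \<in> A} \<in> sets borel"
  proof -
    have "(\<lambda>x. (x - t) / c) \<in> borel_measurable borel" by measurable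
    from measurable_sets[OF this assms(1)] show ?thesis by (simp add: vimage_def)
  qed
  have "emeasure lborel {x. (x - t) / c \<in> A} = (\<integral>\<^sup>+x. indicator {x. (x - t) / c \<in> A} x \<partial>lborel)"
    by simp
  also have "\<dots> = ennreal c * (\<integral>\<^sup>+x. indicator {x. (x - t) / c \<in> A} (t + c * x) \<partial>lborel)"
    using assms by (subst nn_integral_real_affine[where c=c and t=t]) auto
  also have "(\<integral>\<^sup>+x. indicator {x. (x - t) / c \<in> A} (t + c * x) \<partial>lborel) = (\<integral>\<^sup>+x. indicator A x \<partial>lborel)"
    using assms by (intro nn_integral_cong) (auto simp: indicator_def)
  finally show ?thesis using assms by simp
qed

text \<open>Cut \<open>A\<close> just below its supremum at a point \<open>a \<in> A\<close> and \<open>B\<close> just above its infimum at a point \<open>b \<in> B\<close>.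
The sets \<open>(1 - l) A + l b\<close> and \<open>(1 - l) a + l B\<close>, restricted to the two sides of \<open>(1 - l) a + l b\<close>,
are disjoint subsets of \<open>S\<close>, and the cuts lose arbitrarily little mass. The points are taken in \<open>A\<close> and
\<open>B\<close> themselves, so the extrema may fail to be attained.\<close>

lemma brunn_minkowski_real:
  fixes A B S :: "real set"
  assumes [measurable]: "A \<in> sets borel" "B \<in> sets borel" "S \<in> sets borel"
    and bnd: "bounded A" "bounded B" and ne: "A \<noteq> {}" "B \<noteq> {}"
    and l: "0 < l" "l < 1"
    and sub: "\<And>a b. a \<in> A \<Longrightarrow> b \<in> B \<Longrightarrow> (1 - l) * a + l * b \<in> S"
  shows "ennreal (1 - l) * emeasure lborel A + ennreal l * emeasure lborel B \<le> emeasure lborel S"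
proof (rule ennreal_le_epsilon)
  fix e :: real assume e: "0 < e"
  have bdd: "bdd_above A" "bdd_below B"
    using bnd bounded_imp_bdd_above bounded_imp_bdd_below by auto
  obtain a where a: "a \<in> A" "Sup A - e < a"
    using less_cSup_iff[OF ne(1) bdd(1), of "Sup A - e"] e by auto
  obtain b where b: "b \<in> B" "b < Inf B + e"
    using cInf_less_iff[OF ne(2) bdd(2), of "Inf B + e"] e by auto
  have "emeasure lborel A \<le> emeasure lborel ((A \<inter> {..a}) \<union> {a<..Sup A})"
    using bdd by (intro emeasure_mono) (auto intro: cSup_upper)
  also have "\<dots> \<le> emeasure lborel (A \<inter> {..a}) + emeasure lborel {a<..Sup A}"
    by (rule emeasure_subadditive) auto
  also have "emeasure lborel {a<..Sup A} \<le> ennreal e"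
    using a bdd cSup_upper[OF a(1) bdd(1)] by (simp add: ennreal_leI)
  finally have A: "emeasure lborel A \<le> emeasure lborel (A \<inter> {..a}) + ennreal e"
    by (simp add: add_left_mono)
  have "emeasure lborel B \<le> emeasure lborel ((B \<inter> {b<..}) \<union> {Inf B..b})"
    using bdd by (intro emeasure_mono) (auto intro: cInf_lower)
  also have "\<dots> \<le> emeasure lborel (B \<inter> {b<..}) + emeasure lborel {Inf B..b}"
    by (rule emeasure_subadditive) auto
  also have "emeasure lborel {Inf B..b} \<le> ennreal e"
    using b bdd cInf_lower[OF b(1) bdd(2)] by (simp add: ennreal_leI)
  finally have B: "emeasure lborel B \<le> emeasure lborel (B \<inter> {b<..}) + ennreal e"
    by (simp add: add_left_mono)
  define A' where "A' = {x. (x - l * b) / (1 - l) \<in> A \<inter> {..a}}"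
  define B' where "B' = {x. (x - (1 - l) * a) / l \<in> B \<inter> {b<..}}"
  have [measurable]: "A' \<in> sets borel"
  proof -
    have "(\<lambda>x. (x - l * b) / (1 - l)) \<in> borel_measurable borel" by measurable
    from measurable_sets[OF this, of "A \<inter> {..a}"] show ?thesis by (simp add: vimage_def A'_def)
  qed
  have [measurable]: "B' \<in> sets borel"
  proof -
    have "(\<lambda>x. (x - (1 - l) * a) / l) \<in> borel_measurable borel" by measurable
    from measurable_sets[OF this, of "B \<inter> {b<..}"] show ?thesis by (simp add: vimage_def B'_def)
  qed
  have mA: "emeasure lborel A' = ennreal (1 - l) * emeasure lborel (A \<inter> {..a})"
    unfolding A'_def using l by (intro emeasure_lborel_affine_vimage) auto
  have mB: "emeasure lborel B' = ennreal l * emeasure lborel (B \<inter> {b<..})"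
    unfolding B'_def using l by (intro emeasure_lborel_affine_vimage) auto
  have inA: "x \<in> S \<and> x \<le> (1 - l) * a + l * b" if "x \<in> A'" for x
  proof -
    have "(x - l * b) / (1 - l) \<in> A" "(x - l * b) / (1 - l) \<le> a"
      using that by (auto simp: A'_def)
    with l b(1) sub[of "(x - l * b) / (1 - l)" b] show ?thesis
      by (auto simp: pos_divide_le_eq mult.commute)
  qed
  have inB: "x \<in> S \<and> x > (1 - l) * a + l * b" if "x \<in> B'" for x
  proof -
    have "(x - (1 - l) * a) / l \<in> B" "b < (x - (1 - l) * a) / l"
      using that by (auto simp: B'_def)
    with l a(1) sub[of a "(x - (1 - l) * a) / l"] show ?thesis
      by (auto simp: pos_less_divide_eq mult.commute)
  qed
  have "emeasure lborel A' + emeasure lborel B' = emeasure lborel (A' \<union> B')"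
    using inA inB by (intro plus_emeasure) (auto, force)
  also have "\<dots> \<le> emeasure lborel S"
    using inA inB by (intro emeasure_mono) auto
  finally have main: "emeasure lborel A' + emeasure lborel B' \<le> emeasure lborel S" .
  have "ennreal (1 - l) * emeasure lborel A + ennreal l * emeasure lborel B
     \<le> ennreal (1 - l) * (emeasure lborel (A \<inter> {..a}) + ennreal e) + ennreal l * (emeasure lborel (B \<inter> {b<..}) + ennreal e)"
    using A B by (intro add_mono mult_left_mono) auto
  also have "\<dots> = (emeasure lborel A' + emeasure lborel B') + (ennreal (1 - l) * ennreal e + ennreal l * ennreal e)"
    by (simp add: mA mB distrib_left ac_simps)
  also have "ennreal (1 - l) * ennreal e + ennreal l * ennreal e = ennreal e"
    using l e by (simp add: algebra_simps flip: ennreal_mult' ennreal_plus)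
  also have "emeasure lborel A' + emeasure lborel B' + ennreal e \<le> emeasure lborel S + ennreal e"
    using main by (rule add_right_mono)
  finally show "ennreal (1 - l) * emeasure lborel A + ennreal l * emeasure lborel B \<le> emeasure lborel S + ennreal e" .
qed

text \<open>When both functions have supremum 1, their superlevel sets at a level \<open>t < 1\<close> are nonempty and their
combination lies in the superlevel set of \<open>H\<close>. Integrating Brunn--Minkowski over \<open>t\<close> gives an
arithmetic mean of the two integrals, which dominates the geometric one.\<close>

lemma prekopa_leindler_real_normalized:
  fixes F G :: "real \<Rightarrow> real" and H :: "real \<Rightarrow> ennreal"
  assumes [measurable]: "F \<in> borel_measurable borel" "G \<in> borel_measurable borel"
      "H \<in> borel_measurable borel"
    and F: "\<And>x. F x \<le> 1" "bounded {x. F x > 0}" "\<And>t. t < 1 \<Longrightarrow> \<exists>x. t < F x"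
    and G: "\<And>x. G x \<le> 1" "bounded {x. G x > 0}" "\<And>t. t < 1 \<Longrightarrow> \<exists>x. t < G x"
    and l: "0 < l" "l < 1"
    and le: "\<And>u v. ennreal (F u powr (1 - l) * G v powr l) \<le> H ((1 - l) * u + l * v)"
  shows "ennreal (1 - l) * (\<integral>\<^sup>+x. F x \<partial>lborel) + ennreal l * (\<integral>\<^sup>+x. G x \<partial>lborel) \<le> (\<integral>\<^sup>+x. H x \<partial>lborel)"
proof -
  have level: "ennreal (1 - l) * emeasure lborel {x. ennreal t < ennreal (F x)}
      + ennreal l * emeasure lborel {x. ennreal t < ennreal (G x)} \<le> emeasure lborel {x. ennreal t < H x}"
    if t: "0 < t" for t
  proof (cases "t < 1")
    case True
    show ?thesis
    proof (rule brunn_minkowski_real)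
      show "bounded {x. ennreal t < ennreal (F x)}"
        using t by (auto intro!: bounded_subset[OF F(2)] simp: ennreal_less_iff)
      show "bounded {x. ennreal t < ennreal (G x)}"
        using t by (auto intro!: bounded_subset[OF G(2)] simp: ennreal_less_iff)
      show "{x. ennreal t < ennreal (F x)} \<noteq> {}" "{x. ennreal t < ennreal (G x)} \<noteq> {}"
        using F(3)[OF True] G(3)[OF True] t by (auto simp: ennreal_less_iff)
      fix a b assume "a \<in> {x. ennreal t < ennreal (F x)}" "b \<in> {x. ennreal t < ennreal (G x)}"
      then have "t < F a" "t < G b" using t by (auto simp: ennreal_less_iff)
      then have "t powr (1 - l) * t powr l < F a powr (1 - l) * G b powr l"
        using t l by (intro mult_strict_mono powr_less_mono2) auto
      then have "t < F a powr (1 - l) * G b powr l"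
        using t by (simp flip: powr_add)
      then have "ennreal t < ennreal (F a powr (1 - l) * G b powr l)"
        using t by (simp only: ennreal_less_iff less_imp_le)
      also have "\<dots> \<le> H ((1 - l) * a + l * b)" by (rule le)
      finally show "(1 - l) * a + l * b \<in> {x. ennreal t < H x}" by simp
    qed (use l in auto)
  next
    case False
    then have "{x. ennreal t < ennreal (F x)} = {}" "{x. ennreal t < ennreal (G x)} = {}"
      using F(1) G(1) t by (auto simp: ennreal_less_iff not_less intro: order_trans)
    then show ?thesis by simp
  qed
  have "ennreal (1 - l) * (\<integral>\<^sup>+x. F x \<partial>lborel) + ennreal l * (\<integral>\<^sup>+x. G x \<partial>lborel)
     = (\<integral>\<^sup>+t. indicator {0<..} t * (ennreal (1 - l) * emeasure lborel {x. ennreal t < ennreal (F x)}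
      + ennreal l * emeasure lborel {x. ennreal t < ennreal (G x)}) \<partial>lborel)"
    by (subst (1 2) nn_integral_layer_cake)
       (auto simp: distrib_left nn_integral_add nn_integral_cmult mult.left_commute)
  also have "\<dots> \<le> (\<integral>\<^sup>+t. indicator {0<..} t * emeasure lborel {x. ennreal t < H x} \<partial>lborel)"
    using level by (intro nn_integral_mono) (auto simp: indicator_def)
  also have "\<dots> = (\<integral>\<^sup>+x. H x \<partial>lborel)"
    by (rule nn_integral_layer_cake[symmetric]) simp
  finally show ?thesis .
qed

lemma prekopa_leindler_real:
  fixes F G :: "real \<Rightarrow> real" and H :: "real \<Rightarrow> ennreal"
  assumes [measurable]: "F \<in> borel_measurable borel" "G \<in> borel_measurable borel"
      "H \<in> borel_measurable borel"
    and F: "\<And>x. 0 \<le> F x" "\<And>x. F x \<le> C" "bounded {x. F x > 0}"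
    and G: "\<And>x. 0 \<le> G x" "\<And>x. G x \<le> C" "bounded {x. G x > 0}"
    and l: "0 < l" "l < 1"
    and le: "\<And>u v. ennreal (F u powr (1 - l) * G v powr l) \<le> H ((1 - l) * u + l * v)"
  shows "ennreal (enn2real (\<integral>\<^sup>+x. F x \<partial>lborel) powr (1 - l) * enn2real (\<integral>\<^sup>+x. G x \<partial>lborel) powr l)
     \<le> (\<integral>\<^sup>+x. H x \<partial>lborel)"
proof (cases "(\<exists>x. F x > 0) \<and> (\<exists>x. G x > 0)")
  case False
  then have "(\<integral>\<^sup>+x. F x \<partial>lborel) = 0 \<or> (\<integral>\<^sup>+x. G x \<partial>lborel) = 0"
    using F(1) G(1) by (auto simp: not_less ennreal_neg)
  then show ?thesis by auto
next
  case True
  define a where "a = (SUP x. F x)"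
  define b where "b = (SUP x. G x)"
  have bdd: "bdd_above (range F)" "bdd_above (range G)" 
    using F(2) G(2) by (auto intro!: bdd_aboveI)
  have Fa: "F x \<le> a" and Gb: "G x \<le> b" for x
    unfolding a_def b_def using bdd by (auto intro!: cSUP_upper)
  have a: "a > 0" and b: "b > 0"
    using True Fa Gb less_le_trans by blast+
  define c where "c = a powr (1 - l) * b powr l"
  have c: "c > 0" using a b by (simp add: c_def)
  define f where "f x = F x / a" for x
  define g where "g x = G x / b" for x
  have [measurable]: "f \<in> borel_measurable borel" "g \<in> borel_measurable borel"
    unfolding f_def[abs_def] g_def[abs_def] by measurable
  have "ennreal (1 - l) * (\<integral>\<^sup>+x. f x \<partial>lborel) + ennreal l * (\<integral>\<^sup>+x. g x \<partial>lborel)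
    \<le> (\<integral>\<^sup>+x. ennreal (1 / c) * H x \<partial>lborel)"
  proof (rule prekopa_leindler_real_normalized)
    show "\<exists>x. t < f x" if "t < 1" for t
    proof -
      have "t * a < a" using a that by simp
      then obtain x where "t * a < F x"
        unfolding a_def using bdd less_cSUP_iff[of UNIV F] by auto
      then show ?thesis using a by (auto simp: f_def field_simps)
    qed
    show "\<exists>x. t < g x" if "t < 1" for t
    proof -
      have "t * b < b" using b that by simp
      then obtain x where "t * b < G x"
        unfolding b_def using bdd less_cSUP_iff[of UNIV G] by auto
      then show ?thesis using b by (auto simp: g_def field_simps)
    qed
    fix u v
    have "f u powr (1 - l) * g v powr l = 1 / c * (F u powr (1 - l) * G v powr l)"
      using a b F(1) G(1) by (simp add: f_def g_def c_def powr_divide)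
    then have "ennreal (f u powr (1 - l) * g v powr l)
        = ennreal (1 / c) * ennreal (F u powr (1 - l) * G v powr l)"
      using c by (subst ennreal_mult'[symmetric]) auto
    then show "ennreal (f u powr (1 - l) * g v powr l) \<le> ennreal (1 / c) * H ((1 - l) * u + l * v)"
      using mult_left_mono[OF le[of u v], of "ennreal (1 / c)"] by simp
  qed (use a b l F G Fa Gb in \<open>auto simp: f_def g_def zero_less_divide_iff\<close>)
  also have "\<dots> = ennreal (1 / c) * (\<integral>\<^sup>+x. H x \<partial>lborel)"
    by (simp add: nn_integral_cmult)
  finally have lin: "ennreal (1 - l) * (\<integral>\<^sup>+x. f x \<partial>lborel) + ennreal l * (\<integral>\<^sup>+x. g x \<partial>lborel)
      \<le> ennreal (1 / c) * (\<integral>\<^sup>+x. H x \<partial>lborel)" .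
  show ?thesis
  proof (cases "(\<integral>\<^sup>+x. F x \<partial>lborel) \<in> {0, \<infinity>} \<or> (\<integral>\<^sup>+x. G x \<partial>lborel) \<in> {0, \<infinity>}")
    case True
    then show ?thesis by auto
  next
    case fin: False
    obtain p where p: "0 < p" "(\<integral>\<^sup>+x. F x \<partial>lborel) = ennreal p"
      using fin by (cases "\<integral>\<^sup>+x. F x \<partial>lborel") (auto simp: less_le)
    obtain q where q: "0 < q" "(\<integral>\<^sup>+x. G x \<partial>lborel) = ennreal q"
      using fin by (cases "\<integral>\<^sup>+x. G x \<partial>lborel") (auto simp: less_le)
    have fi: "(\<integral>\<^sup>+x. f x \<partial>lborel) = ennreal (p / a)"
      using a p F(1) by (simp add: f_def nn_integral_divide flip: divide_ennreal)
    have gi: "(\<integral>\<^sup>+x. g x \<partial>lborel) = ennreal (q / b)"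
      using b q G(1) by (simp add: g_def nn_integral_divide flip: divide_ennreal)
    have "p powr (1 - l) * q powr l = c * ((p / a) powr (1 - l) * (q / b) powr l)"
      using a b p q by (simp add: c_def powr_divide)
    also have "\<dots> \<le> c * ((1 - l) * (p / a) + l * (q / b))"
      using c a b p q l by (intro mult_left_mono Youngs_inequality_0) auto
    finally have "ennreal (p powr (1 - l) * q powr l) \<le> ennreal c * (ennreal (1 - l) * ennreal (p / a) + ennreal l * ennreal (q / b))"
      using c a b p q l by (simp flip: ennreal_mult' ennreal_plus)
    also have "\<dots> \<le> ennreal c * (ennreal (1 / c) * (\<integral>\<^sup>+x. H x \<partial>lborel))"
      using lin by (intro mult_left_mono) (simp_all add: fi gi)
    also have "\<dots> = (\<integral>\<^sup>+x. H x \<partial>lborel)"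
      using c by (simp add: mult.assoc[symmetric] flip: ennreal_mult')
    finally show ?thesis using p q by simp
  qed
qed

text \<open>Induction over the coordinates: for fixed values of the last coordinate the induction hypothesis
applies to the sections, and it says exactly that the marginals satisfy the one-dimensional
hypothesis. Bounded functions with bounded support keep the marginals finite and in the same class;
\<open>H\<close> has values in \<open>ennreal\<close> because its marginals may be infinite.\<close>

lemma prekopa_leindler_PiM:
  fixes F G :: "('i \<Rightarrow> real) \<Rightarrow> real" and H :: "('i \<Rightarrow> real) \<Rightarrow> ennreal"
  assumes "finite I" and l: "0 < l" "l < 1" and R: "0 \<le> R"
    and "F \<in> borel_measurable (Pi\<^sub>M I (\<lambda>_. lborel))" "G \<in> borel_measurable (Pi\<^sub>M I (\<lambda>_. lborel))"
      "H \<in> borel_measurable (Pi\<^sub>M I (\<lambda>_. lborel))"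
    and "0 \<le> C" "\<And>x. 0 \<le> F x" "\<And>x. F x \<le> C" "\<And>x i. F x > 0 \<Longrightarrow> i \<in> I \<Longrightarrow> \<bar>x i\<bar> \<le> R"
    and "\<And>x. 0 \<le> G x" "\<And>x. G x \<le> C" "\<And>x i. G x > 0 \<Longrightarrow> i \<in> I \<Longrightarrow> \<bar>x i\<bar> \<le> R"
    and "\<And>u v. ennreal (F u powr (1 - l) * G v powr l) \<le> H (\<lambda>i. (1 - l) * u i + l * v i)"
  shows "ennreal (enn2real (\<integral>\<^sup>+x. F x \<partial>Pi\<^sub>M I (\<lambda>_. lborel)) powr (1 - l)
            * enn2real (\<integral>\<^sup>+x. G x \<partial>Pi\<^sub>M I (\<lambda>_. lborel)) powr l)
     \<le> (\<integral>\<^sup>+x. H x \<partial>Pi\<^sub>M I (\<lambda>_. lborel))"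
  using assms(1,5-)
proof (induction I arbitrary: F G H C rule: finite_induct)
  case empty
  \<comment> \<open>the only point of the empty product is the constantly undefined function, and convex combinations fix it\<close>
  have u: "(\<lambda>i. (1 - l) * undefined + l * undefined) = (\<lambda>i. undefined :: real)"
    by (simp add: algebra_simps)
  interpret product_sigma_finite "\<lambda>_. lborel :: real measure" by standard
  have "ennreal (F (\<lambda>i. undefined) powr (1 - l) * G (\<lambda>i. undefined) powr l) \<le> H (\<lambda>i. undefined)"
    using empty(11)[of "\<lambda>i. undefined" "\<lambda>i. undefined"] by (simp only: u)
  then show ?case
    using empty(5,8) by (simp add: nn_integral_empty)
next
  case (insert i I)
  interpret product_sigma_finite "\<lambda>_. lborel :: real measure" by standard
  note [measurable] = insert.prems(1-3)
  let ?P = "Pi\<^sub>M I (\<lambda>_. lborel :: real measure)"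
  have fin: "(\<integral>\<^sup>+x. f (x(i := s)) \<partial>?P) \<le> ennreal (C * (2 * R) ^ card I)"
    if f: "\<And>x. f x \<le> C" "\<And>x i'. f x > 0 \<Longrightarrow> i' \<in> insert i I \<Longrightarrow> \<bar>x i'\<bar> \<le> R"
    for f :: "('i \<Rightarrow> real) \<Rightarrow> real" and s
  proof -
    have "(\<integral>\<^sup>+x. f (x(i := s)) \<partial>?P) \<le> (\<integral>\<^sup>+x. ennreal C * indicator (\<Pi>\<^sub>E i\<in>I. {-R..R}) x \<partial>?P)"
    proof (intro nn_integral_mono)
      fix x assume x: "x \<in> space ?P"
      show "ennreal (f (x(i := s))) \<le> ennreal C * indicator (\<Pi>\<^sub>E i\<in>I. {-R..R}) x"
      proof (cases "f (x(i := s)) > 0")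
        case True
        have "\<bar>x i'\<bar> \<le> R" if "i' \<in> I" for i'
          using f(2)[OF True, of i'] that insert.hyps(2) by (auto split: if_splits)
        then have "x \<in> (\<Pi>\<^sub>E i\<in>I. {-R..R})"
          using x by (simp add: space_PiM PiE_iff abs_le_iff minus_le_iff)
        then show ?thesis using ennreal_leI[OF f(1)[of "x(i := s)"]] by simp
      next
        case False
        then show ?thesis by (simp add: ennreal_neg)
      qed
    qed
    also have "\<dots> = ennreal C * (\<Prod>j\<in>I. emeasure lborel {-R..R})"
      using insert.hyps(1) by (subst nn_integral_cmult_indicator) (auto simp: emeasure_PiM)
    also have "\<dots> = ennreal (C * (2 * R) ^ card I)"
      using R insert.prems(4) by (subst ennreal_mult) (simp_all add: ennreal_power del: power_mult_distrib)
    finally show ?thesis .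
  qed
  have finF: "(\<integral>\<^sup>+x. F (x(i := s)) \<partial>?P) \<le> ennreal (C * (2 * R) ^ card I)" for s
    by (rule fin) (use insert.prems(6,7) in blast)+
  have finG: "(\<integral>\<^sup>+x. G (x(i := s)) \<partial>?P) \<le> ennreal (C * (2 * R) ^ card I)" for s
    by (rule fin) (use insert.prems(9,10) in blast)+
  define marg where "marg f s = enn2real (\<integral>\<^sup>+x. f (x(i := s)) \<partial>?P)" for f :: "('i \<Rightarrow> real) \<Rightarrow> real" and s
  have margF: "(\<integral>\<^sup>+x. F (x(i := s)) \<partial>?P) = ennreal (marg F s)"
    and margG: "(\<integral>\<^sup>+x. G (x(i := s)) \<partial>?P) = ennreal (marg G s)" for s
    using finF[of s] finG[of s] by (auto simp: marg_def ennreal_enn2real_if top_unique)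
  have upd [measurable]: "(\<lambda>(s, x). x(i := s)) \<in> measurable (lborel \<Otimes>\<^sub>M ?P) (Pi\<^sub>M (insert i I) (\<lambda>_. lborel))"
    unfolding split_beta' by (rule measurable_fun_upd[where J=I]) auto
  have sect [measurable]: "(\<lambda>x. x(i := s)) \<in> measurable ?P (Pi\<^sub>M (insert i I) (\<lambda>_. lborel))" for s :: real
    by (rule measurable_fun_upd[where J=I]) auto
  interpret I: finite_product_sigma_finite "\<lambda>_. lborel :: real measure" I
    using insert.hyps(1) by unfold_locales
  have marginal_measurable [measurable]: "(\<lambda>s. \<integral>\<^sup>+x. h (x(i := s)) \<partial>?P) \<in> borel_measurable borel"
    if [measurable]: "h \<in> borel_measurable (Pi\<^sub>M (insert i I) (\<lambda>_. lborel))" for h :: "('i \<Rightarrow> real) \<Rightarrow> ennreal"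
  proof -
    have "(\<lambda>(s, x). h (x(i := s))) \<in> borel_measurable (lborel \<Otimes>\<^sub>M ?P)"
      using measurable_compose[OF upd that] by (simp add: split_beta')
    from I.borel_measurable_nn_integral[OF this] show ?thesis by simp
  qed
  have [measurable]: "marg F \<in> borel_measurable borel" "marg G \<in> borel_measurable borel"
    unfolding marg_def[abs_def]
    by measurable
  have "ennreal (enn2real (\<integral>\<^sup>+s. marg F s \<partial>lborel) powr (1 - l) * enn2real (\<integral>\<^sup>+s. marg G s \<partial>lborel) powr l)
     \<le> (\<integral>\<^sup>+s. \<integral>\<^sup>+x. H (x(i := s)) \<partial>?P \<partial>lborel)"
  proof (rule prekopa_leindler_real)
    show "marg F s \<le> C * (2 * R) ^ card I" "marg G s \<le> C * (2 * R) ^ card I" for s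
      using finF[of s] finG[of s] R insert.prems(4)
      by (auto simp: margF margG)
    show "0 \<le> marg F s" "0 \<le> marg G s" for s by (auto simp: marg_def)
    have supp: "bounded {s. 0 < marg f s}"
      if f: "\<And>x. 0 \<le> f x" "\<And>x i'. f x > 0 \<Longrightarrow> i' \<in> insert i I \<Longrightarrow> \<bar>x i'\<bar> \<le> R" for f
    proof (rule bounded_subset[OF bounded_closed_interval[of "-R" R]], safe)
      fix s assume "0 < marg f s"
      have "\<exists>x. f (x(i := s)) > 0"
      proof (rule ccontr)
        assume "\<not> ?thesis"
        then have "f (x(i := s)) = 0" for x
          using f(1)[of "x(i := s)"] by (simp add: not_less order_antisym)
        with \<open>0 < marg f s\<close> show False by (simp add: marg_def)
      qed
      then obtain x where "f (x(i := s)) > 0" by auto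
      from f(2)[OF this, of i] show "s \<in> {-R..R}" by auto
    qed
    show "bounded {s. 0 < marg F s}"
      by (rule supp) (use insert.prems(5,7) in blast)+
    show "bounded {s. 0 < marg G s}"
      by (rule supp) (use insert.prems(8,10) in blast)+
    fix s t
    show "ennreal (marg F s powr (1 - l) * marg G t powr l) \<le> (\<integral>\<^sup>+x. H (x(i := (1 - l) * s + l * t)) \<partial>?P)"
      unfolding marg_def
    proof (rule insert.IH)
      show "(\<lambda>x. F (x(i := s))) \<in> borel_measurable ?P" "(\<lambda>x. G (x(i := t))) \<in> borel_measurable ?P"
        "(\<lambda>x. H (x(i := (1 - l) * s + l * t))) \<in> borel_measurable ?P"
        by measurable
      show "\<bar>x i'\<bar> \<le> R" if "0 < F (x(i := s))" "i' \<in> I" for x i'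
        using insert.prems(7)[OF that(1), of i'] that insert.hyps by (auto split: if_splits)
      show "\<bar>x i'\<bar> \<le> R" if "0 < G (x(i := t))" "i' \<in> I" for x i'
        using insert.prems(10)[OF that(1), of i'] that insert.hyps by (auto split: if_splits)
      fix u v
      have "(\<lambda>j. (1 - l) * (u(i := s)) j + l * (v(i := t)) j) = (\<lambda>j. (1 - l) * u j + l * v j)(i := (1 - l) * s + l * t)"
        by auto
      then show "ennreal (F (u(i := s)) powr (1 - l) * G (v(i := t)) powr l)
          \<le> H ((\<lambda>j. (1 - l) * u j + l * v j)(i := (1 - l) * s + l * t))"
        using insert.prems(11)[of "u(i := s)" "v(i := t)"] by (simp only:)
    qed (rule insert.prems)+
  next
    show "(\<lambda>s. \<integral>\<^sup>+x. H (x(i := s)) \<partial>?P) \<in> borel_measurable borel"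
      using insert.prems(3) by (rule marginal_measurable)
  qed (use l in simp_all)
  then show ?case
    using insert.hyps by (simp add: product_nn_integral_insert_rev margF margG)
qed

theorem prekopa_leindler_bounded:
  fixes F G :: "'a::euclidean_space \<Rightarrow> real" and H :: "'a \<Rightarrow> ennreal"
  assumes [measurable]: "F \<in> borel_measurable borel" "G \<in> borel_measurable borel"
      "H \<in> borel_measurable borel"
    and l: "0 < l" "l < 1"
    and F: "\<And>x. 0 \<le> F x" "\<And>x. F x \<le> C" "\<And>x. F x > 0 \<Longrightarrow> norm x \<le> R"
    and G: "\<And>x. 0 \<le> G x" "\<And>x. G x \<le> C" "\<And>x. G x > 0 \<Longrightarrow> norm x \<le> R"
    and le: "\<And>u v. ennreal (F u powr (1 - l) * G v powr l) \<le> H ((1 - l) *\<^sub>R u + l *\<^sub>R v)"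
  shows "ennreal (enn2real (\<integral>\<^sup>+x. F x \<partial>lborel) powr (1 - l) * enn2real (\<integral>\<^sup>+x. G x \<partial>lborel) powr l)
     \<le> (\<integral>\<^sup>+x. H x \<partial>lborel)"
proof -
  define e where "e \<omega> = (\<Sum>b\<in>Basis. \<omega> b *\<^sub>R b)" for \<omega> :: "'a \<Rightarrow> real"
  let ?P = "Pi\<^sub>M (Basis :: 'a set) (\<lambda>_. lborel :: real measure)"
  have e [measurable]: "e \<in> measurable ?P borel"
    unfolding e_def by measurable
  have eq: "(\<integral>\<^sup>+x. h x \<partial>lborel) = (\<integral>\<^sup>+\<omega>. h (e \<omega>) \<partial>?P)" if [measurable]: "h \<in> borel_measurable borel" for h :: "'a \<Rightarrow> ennreal"
    by (subst lborel_eq) (simp add: nn_integral_distr e_def[symmetric])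
  have C: "0 \<le> C" using F(1,2) order_trans by blast
  have coord: "\<bar>\<omega> i\<bar> \<le> R" if "norm (e \<omega>) \<le> R" "i \<in> Basis" for \<omega> i
  proof -
    have "\<omega> i = e \<omega> \<bullet> i" using that(2) by (simp add: e_def)
    with that show ?thesis by (metis Basis_le_norm order_trans)
  qed
  have lin: "e (\<lambda>i. (1 - l) * u i + l * v i) = (1 - l) *\<^sub>R e u + l *\<^sub>R e v" for u v
    by (simp add: e_def scaleR_add_left sum.distrib scaleR_sum_right)
  show ?thesis
  proof (subst (1 2 3) eq)
    show "ennreal (enn2real (\<integral>\<^sup>+\<omega>. F (e \<omega>) \<partial>?P) powr (1 - l) * enn2real (\<integral>\<^sup>+\<omega>. G (e \<omega>) \<partial>?P) powr l)
       \<le> (\<integral>\<^sup>+\<omega>. H (e \<omega>) \<partial>?P)"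
    proof (rule prekopa_leindler_PiM[where R="max R 0" and C=C])
      show "\<bar>x i\<bar> \<le> max R 0" if "0 < F (e x)" "i \<in> Basis" for x i
        using coord[OF F(3)[OF that(1)] that(2)] by simp
      show "\<bar>x i\<bar> \<le> max R 0" if "0 < G (e x)" "i \<in> Basis" for x i
        using coord[OF G(3)[OF that(1)] that(2)] by simp
    qed (use l F(1,2) G(1,2) C le in \<open>simp_all add: lin\<close>)
  qed auto
qed

text \<open>Truncation removes boundedness: the truncated functions stay below \<open>F\<close> and \<open>G\<close>, hence satisfy the
hypothesis with the same \<open>H\<close>.\<close>

theorem prekopa_leindler:
  fixes F G :: "'a::euclidean_space \<Rightarrow> real" and H :: "'a \<Rightarrow> ennreal"
  assumes F: "integrable lborel F" "\<And>x. 0 \<le> F x" and G: "integrable lborel G" "\<And>x. 0 \<le> G x"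
    and [measurable]: "H \<in> borel_measurable borel"
    and l: "0 < l" "l < 1"
    and le: "\<And>u v. ennreal (F u powr (1 - l) * G v powr l) \<le> H ((1 - l) *\<^sub>R u + l *\<^sub>R v)"
  shows "ennreal ((LINT x|lborel. F x) powr (1 - l) * (LINT x|lborel. G x) powr l)
     \<le> (\<integral>\<^sup>+x. H x \<partial>lborel)"
proof -
  have [measurable]: "F \<in> borel_measurable borel" "G \<in> borel_measurable borel"
    using F(1) G(1) by auto
  define T where "T f n x = (if norm x \<le> real n then min (f x) (real n) else 0)" 
    for f :: "'a \<Rightarrow> real" and n :: nat and x
  have [measurable]: "T f n \<in> borel_measurable borel" if [measurable]: "f \<in> borel_measurable borel" for f n
    unfolding T_def[abs_def] by measurable
  have T: "0 \<le> T f n x" "T f n x \<le> real n" "T f n x \<le> f x" "T f n x > 0 \<Longrightarrow> norm x \<le> real n" 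
    if "\<And>x. 0 \<le> f x" for f n x
    using that[of x] by (auto simp: T_def split: if_splits)
  have lim: "(\<lambda>n. LINT x|lborel. T f n x) \<longlonglongrightarrow> (LINT x|lborel. f x)" 
    if f: "integrable lborel f" "\<And>x. 0 \<le> f x" for f
  proof (rule integral_dominated_convergence[where w=f])
    show "AE x in lborel. (\<lambda>n. T f n x) \<longlonglongrightarrow> f x"
    proof (intro AE_I2)
      fix x
      obtain N where N: "max (f x) (norm x) \<le> real N" using real_arch_simple by blast
      have "T f n x = f x" if "n \<ge> N" for n
        using N that by (auto simp: T_def min_def)
      then show "(\<lambda>n. T f n x) \<longlonglongrightarrow> f x"
        by (intro tendsto_eventually) (auto simp: eventually_sequentially)
    qed
  qed (use f T[of f] in auto)
  have enn: "enn2real (\<integral>\<^sup>+x. T f n x \<partial>lborel) = (LINT x|lborel. T f n x)" 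
    if [measurable]: "f \<in> borel_measurable borel" and "\<And>x. 0 \<le> f x" for f n
    using T[of f] that by (subst integral_eq_nn_integral) auto
  have le_n: "ennreal ((LINT x|lborel. T F n x) powr (1 - l) * (LINT x|lborel. T G n x) powr l)
      \<le> (\<integral>\<^sup>+x. H x \<partial>lborel)" for n
  proof -
    have "ennreal (T F n u powr (1 - l) * T G n v powr l) \<le> H ((1 - l) *\<^sub>R u + l *\<^sub>R v)" for u v
    proof (rule order_trans[OF ennreal_leI le])
      show "T F n u powr (1 - l) * T G n v powr l \<le> F u powr (1 - l) * G v powr l"
        using T[of F] T[of G] F(2) G(2) l by (intro mult_mono powr_mono2) auto
    qed
    then have "ennreal (enn2real (\<integral>\<^sup>+x. T F n x \<partial>lborel) powr (1 - l)
        * enn2real (\<integral>\<^sup>+x. T G n x \<partial>lborel) powr l) \<le> (\<integral>\<^sup>+x. H x \<partial>lborel)"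
      using l T[of F] T[of G] F(2) G(2)
      by (intro prekopa_leindler_bounded[where C="real n" and R="real n"]) auto
    then show ?thesis using F(2) G(2) by (simp add: enn)
  qed
  have lim_n: "(\<lambda>n. ennreal ((LINT x|lborel. T F n x) powr (1 - l) * (LINT x|lborel. T G n x) powr l))
    \<longlonglongrightarrow> ennreal ((LINT x|lborel. F x) powr (1 - l) * (LINT x|lborel. G x) powr l)"
    using l T(1)[of F] T(1)[of G] F(2) G(2)
    by (intro tendsto_ennrealI tendsto_mult tendsto_powr2 lim F G tendsto_const) 
       (auto intro!: always_eventually integral_nonneg_AE)
  show ?thesis
    using lim_n by (rule LIMSEQ_le_const2) (use le_n in blast)
qed

section \<open>Exponential moments\<close>

text \<open>The defect term on the right is the strong convexity of the quadratic part of the potentials; it is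
what pays for the transport cost below.\<close>

lemma norm_sq_convex_combination:
  fixes a b :: "'a::real_inner"
  shows "(norm ((1 - l) *\<^sub>R a + l *\<^sub>R b))\<^sup>2
    = (1 - l) * (norm a)\<^sup>2 + l * (norm b)\<^sup>2 - l * (1 - l) * (norm (a - b))\<^sup>2"
  unfolding power2_norm_eq_inner
  by (simp add: inner_simps inner_commute algebra_simps)

lemma (in prob_space) exp_expectation_le:
  fixes X :: "'a \<Rightarrow> real"
  assumes "integrable M X" "integrable M (\<lambda>x. exp (X x))"
  shows "exp (expectation X) \<le> expectation (\<lambda>x. exp (X x))"
proof -
  let ?e = "exp (expectation X)"
  have "?e * (1 + (X x - expectation X)) \<le> exp (X x)" for x
  proof -
    have "?e * (1 + (X x - expectation X)) \<le> ?e * exp (X x - expectation X)"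
      using exp_ge_add_one_self[of "X x - expectation X"] by simp
    then show ?thesis by (simp flip: exp_add)
  qed
  then have "expectation (\<lambda>x. ?e * (1 + (X x - expectation X))) \<le> expectation (\<lambda>x. exp (X x))"
    using assms by (intro integral_mono) auto
  then show ?thesis using assms(1) by (simp add: prob_space)
qed

text \<open>The Gibbs variational principle is used in this form throughout: with \<open>X = g - ln (dM / dN)\<close> it bounds
\<open>\<integral> g dM\<close> by the log-moment of \<open>g\<close> under \<open>N\<close> plus the relative entropy of \<open>M\<close> with respect to \<open>N\<close>.\<close>

lemma (in prob_space) expectation_le_ln_expectation_exp:
  fixes X :: "'a \<Rightarrow> real"
  assumes "integrable M X" "integrable M (\<lambda>x. exp (X x))"
  shows "expectation X \<le> ln (expectation (\<lambda>x. exp (X x)))"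
proof -
  have "exp (expectation X) \<le> expectation (\<lambda>x. exp (X x))"
    using assms by (rule exp_expectation_le)
  then show ?thesis
    by (subst ln_ge_iff) (auto intro: less_le_trans[OF exp_gt_zero])
qed

lemma (in prob_space) expectation_ln_le:
  fixes g :: "'a \<Rightarrow> real"
  assumes [measurable]: "g \<in> borel_measurable M" and g: "\<And>x. 1 \<le> g x" "\<And>x. g x \<le> b"
  shows "expectation (\<lambda>x. ln (g x)) \<le> ln (expectation g)"
proof -
  have pos: "0 < g x" for x using g(1)[of x] by simp
  have "integrable M g"
    by (rule integrable_const_bound[where B=b]) (use g pos in \<open>auto simp: less_imp_le\<close>)
  moreover have "integrable M (\<lambda>x. ln (g x))"
    by (rule integrable_const_bound[where B="ln b"]) (use g pos in \<open>auto intro!: ln_mono\<close>)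
  ultimately show ?thesis
    using expectation_le_ln_expectation_exp[of "\<lambda>x. ln (g x)"] pos by simp
qed

text \<open>Lets a Gaussian factor absorb a linear one; it gives integrability of linear functions.\<close>

lemma le_exp_square:
  fixes r \<tau> :: real
  assumes \<tau>: "0 < \<tau>"
  shows "r \<le> (1 + \<tau>) * exp (r\<^sup>2 / (2 * \<tau>))"
proof -
  have "0 \<le> (r - \<tau>)\<^sup>2 / (2 * \<tau>)" using \<tau> by simp
  also have "\<dots> = r\<^sup>2 / (2 * \<tau>) - r + \<tau> / 2"
    using \<tau> by (simp add: field_simps power2_eq_square)
  finally have "r \<le> 1 * (r\<^sup>2 / (2 * \<tau>)) + (1 + \<tau>)" using \<tau> by simp
  also have "\<dots> \<le> (1 + \<tau>) * (r\<^sup>2 / (2 * \<tau>)) + (1 + \<tau>)"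
    using \<tau> by (intro add_mono mult_right_mono) auto
  also have "\<dots> = (1 + \<tau>) * (1 + r\<^sup>2 / (2 * \<tau>))" by (simp add: distrib_left)
  also have "\<dots> \<le> (1 + \<tau>) * exp (r\<^sup>2 / (2 * \<tau>))"
    using \<tau> by (intro mult_left_mono exp_ge_add_one_self) auto
  finally show ?thesis .
qed

lemma lborel_integral_pos:
  fixes g :: "'a::euclidean_space \<Rightarrow> real"
  assumes g: "integrable lborel g" "\<And>x. 0 < g x"
  shows "0 < (LINT x|lborel. g x)"
proof -
  have "(LINT x|lborel. g x) \<ge> 0" using g by (intro integral_nonneg_AE) (simp add: less_imp_le)
  moreover have "(LINT x|lborel. g x) \<noteq> 0"
  proof
    assume "(LINT x|lborel. g x) = 0"
    then have "AE x in lborel. g x = 0"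
      using g(2)[THEN less_imp_le] by (subst (asm) integral_nonneg_eq_0_iff_AE[OF g(1)]) auto
    then have "AE x::'a in lborel. False"
      by (rule AE_mp) (use g(2) in \<open>auto simp: less_le\<close>)
    then show False by (simp add: AE_iff_measurable[where N=UNIV])
  qed
  ultimately show ?thesis by simp
qed

section \<open>The backward step\<close>

locale proximal_sampler =
  fixes f :: "'a::euclidean_space \<Rightarrow> real" and \<eta> :: real
  assumes convex_f: "convex_on UNIV f"
    and integrable_exp_f: "integrable lborel (\<lambda>x. exp (- f x))"
    and eta_pos: "\<eta> > 0"
begin

abbreviation w where "w \<equiv> joint_weight f \<eta>"
abbreviation Q where "Q \<equiv> cond_X_given_Y f \<eta>"

definition Z :: "'a \<Rightarrow> real" where
  "Z y = (LINT x|lborel. w x y)"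

lemma measurable_f [measurable]: "f \<in> borel_measurable borel"
  using convex_on_continuous[OF open_UNIV convex_f]
  by (rule borel_measurable_continuous_onI)

lemma measurable_w [measurable]: "(\<lambda>(x, y). w x y) \<in> borel_measurable (borel \<Otimes>\<^sub>M borel)"
  unfolding joint_weight_def by measurable

lemma w_pos: "0 < w x y"
  by (simp add: joint_weight_def)

lemma w_le: "w x y \<le> exp (- f x)"
  using eta_pos by (simp add: joint_weight_def)

lemma integrable_w: "integrable lborel (\<lambda>x. w x y)"
  by (rule Bochner_Integration.integrable_bound[OF integrable_exp_f])
     (use w_pos w_le in \<open>auto simp: less_imp_le\<close>)

lemma Z_pos: "0 < Z y"
  unfolding Z_def using integrable_w w_pos by (rule lborel_integral_pos)

lemma Q_eq: "Q y = density lborel (\<lambda>x. ennreal (w x y / Z y))"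
  by (simp add: cond_X_given_Y_def normalized_measure_def Z_def)

lemma sets_Q [simp, measurable_cong]: "sets (Q y) = sets borel"
  and space_Q [simp]: "space (Q y) = UNIV"
  by (simp_all add: Q_eq)

lemma prob_space_Q: "prob_space (Q y)"
proof
  have "emeasure (Q y) (space (Q y)) = (\<integral>\<^sup>+x. ennreal (w x y / Z y) \<partial>lborel)"
    by (simp add: Q_eq emeasure_density)
  also have "\<dots> = ennreal (LINT x|lborel. w x y / Z y)"
    using integrable_w w_pos[THEN less_imp_le] Z_pos[of y] by (intro nn_integral_eq_integral) auto
  also have "(LINT x|lborel. w x y / Z y) = 1"
    using Z_pos[of y] by (simp add: Z_def)
  finally show "emeasure (Q y) (space (Q y)) = 1" by simp
qed

lemma integral_Q:
  assumes [measurable]: "g \<in> borel_measurable borel"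
  shows "(LINT x|lborel. w x y * g x) = Z y * (LINT x|Q y. g x)"
  using Z_pos[of y] w_pos[THEN less_imp_le]
  by (simp add: Q_eq integral_density)

lemma integrable_Q_iff:
  assumes [measurable]: "g \<in> borel_measurable borel"
  shows "integrable (Q y) g \<longleftrightarrow> integrable lborel (\<lambda>x. w x y * g x)"
proof -
  have "integrable (Q y) g \<longleftrightarrow> integrable lborel (\<lambda>x. (1 / Z y) * (w x y * g x))"
    using Z_pos[of y] w_pos[THEN less_imp_le]
    by (simp add: Q_eq integrable_density)
  then show ?thesis
    using Z_pos[of y] by (subst (asm) integrable_mult_left_iff) simp
qed

lemma integrable_Q_bounded:
  fixes g :: "'a \<Rightarrow> real"
  assumes "g \<in> borel_measurable borel" "\<And>x. \<bar>g x\<bar> \<le> B"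
  shows "integrable (Q y) g"
proof -
  interpret prob_space "Q y" by (rule prob_space_Q)
  show ?thesis using assms by (intro integrable_const_bound[where B=B]) auto
qed

text \<open>The joint weight is log-concave in \<open>(x, y)\<close>, and by Prekopa--Leindler so are its marginals.\<close>

lemma Z_log_concave:
  assumes l: "0 < l" "l < 1"
  shows "(1 - l) * ln (Z y) + l * ln (Z y') \<le> ln (Z ((1 - l) *\<^sub>R y + l *\<^sub>R y'))"
proof -
  let ?y = "(1 - l) *\<^sub>R y + l *\<^sub>R y'"
  have "ennreal ((LINT x|lborel. w x y) powr (1 - l) * (LINT x|lborel. w x y') powr l)
     \<le> (\<integral>\<^sup>+x. ennreal (w x ?y) \<partial>lborel)"
  proof (rule prekopa_leindler)
    fix u v :: 'a
    let ?m = "(1 - l) *\<^sub>R u + l *\<^sub>R v"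
    have f: "f ?m \<le> (1 - l) * f u + l * f v"
      using convex_onD[OF convex_f, of l u v] l by (simp add: add.commute)
    have eq: "?m - ?y = (1 - l) *\<^sub>R (u - y) + l *\<^sub>R (v - y')"
      by (simp add: algebra_simps)
    have "(norm (?m - ?y))\<^sup>2 \<le> (1 - l) * (norm (u - y))\<^sup>2 + l * (norm (v - y'))\<^sup>2"
      unfolding eq norm_sq_convex_combination using l by simp
    then have "(norm (?m - ?y))\<^sup>2 / (2 * \<eta>) \<le> ((1 - l) * (norm (u - y))\<^sup>2 + l * (norm (v - y'))\<^sup>2) / (2 * \<eta>)"
      using eta_pos by (intro divide_right_mono) auto
    also have "\<dots> = (1 - l) * ((norm (u - y))\<^sup>2 / (2 * \<eta>)) + l * ((norm (v - y'))\<^sup>2 / (2 * \<eta>))"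
      by (simp add: add_divide_distrib)
    finally have q: "(norm (?m - ?y))\<^sup>2 / (2 * \<eta>) \<le>
      (1 - l) * ((norm (u - y))\<^sup>2 / (2 * \<eta>)) + l * ((norm (v - y'))\<^sup>2 / (2 * \<eta>))" .
    have "(- f u - p) * (1 - l) + (- f v - q) * l = - ((1 - l) * f u + l * f v) - ((1 - l) * p + l * q)" for p q
      by (simp add: algebra_simps)
    note this[of "(norm (u - y))\<^sup>2 / (2 * \<eta>)" "(norm (v - y'))\<^sup>2 / (2 * \<eta>)"]
    then have "(- f u - (norm (u - y))\<^sup>2 / (2 * \<eta>)) * (1 - l) + (- f v - (norm (v - y'))\<^sup>2 / (2 * \<eta>)) * l
       \<le> - f ?m - (norm (?m - ?y))\<^sup>2 / (2 * \<eta>)"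
      using f q by linarith
    then show "ennreal (w u y powr (1 - l) * w v y' powr l) \<le> ennreal (w ?m ?y)"
      unfolding joint_weight_def exp_powr_real exp_add[symmetric]
      by (intro ennreal_leI) simp
  qed (use integrable_w w_pos[THEN less_imp_le] l in auto)
  also have "\<dots> = ennreal (Z ?y)"
    unfolding Z_def using integrable_w w_pos[THEN less_imp_le] by (intro nn_integral_eq_integral) auto
  finally have "Z y powr (1 - l) * Z y' powr l \<le> Z ?y"
    using Z_pos[of ?y] by (simp add: Z_def[symmetric])
  then have "ln (Z y powr (1 - l) * Z y' powr l) \<le> ln (Z ?y)"
    using Z_pos[of y] Z_pos[of y'] by (intro ln_mono) auto
  then show ?thesis
    using Z_pos[of y] Z_pos[of y'] by (simp add: ln_mult ln_powr)
qed

lemma integrable_Q_linear: "integrable (Q y) (\<lambda>x. (x - y) \<bullet> d)"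
proof -
  have "integrable lborel (\<lambda>x. w x y * ((x - y) \<bullet> d))"
  proof (rule Bochner_Integration.integrable_bound)
    show "integrable lborel (\<lambda>x. (1 + \<eta>) * norm d * exp (- f x))"
      using integrable_exp_f by simp
    have "norm (w x y * ((x - y) \<bullet> d)) \<le> norm ((1 + \<eta>) * norm d * exp (- f x))" for x
    proof -
      let ?r = "norm (x - y)"
      have "?r \<le> (1 + \<eta>) * exp (?r\<^sup>2 / (2 * \<eta>))"
        using eta_pos by (rule le_exp_square)
      then have r: "?r * exp (- (?r\<^sup>2 / (2 * \<eta>))) \<le> 1 + \<eta>"
        by (simp add: exp_minus field_simps)
      have "norm (w x y * ((x - y) \<bullet> d)) = w x y * \<bar>(x - y) \<bullet> d\<bar>"
        using w_pos[of x y] by (simp add: abs_mult)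
      also have "\<dots> \<le> w x y * (?r * norm d)"
        using w_pos[of x y] by (intro mult_left_mono Cauchy_Schwarz_ineq2) auto
      also have "\<dots> = (?r * exp (- (?r\<^sup>2 / (2 * \<eta>)))) * (norm d * exp (- f x))"
        by (simp add: joint_weight_def exp_diff exp_minus field_simps)
      also have "\<dots> \<le> (1 + \<eta>) * (norm d * exp (- f x))"
        using r by (intro mult_right_mono) auto
      finally show ?thesis using eta_pos by simp
    qed
    then show "AE x in lborel. norm (w x y * ((x - y) \<bullet> d)) \<le> norm ((1 + \<eta>) * norm d * exp (- f x))"
      by simp
  qed simp
  then show ?thesis by (simp add: integrable_Q_iff)
qed

text \<open>Moving the centre \<open>y\<close> is the same as tilting the weight by the exponential of a linear function.\<close>

lemma w_shift:
  "w x (y + d) = w x y * exp ((x - y) \<bullet> d / \<eta> - (norm d)\<^sup>2 / (2 * \<eta>))"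
proof -
  have "(norm (x - (y + d)))\<^sup>2 = (norm (x - y))\<^sup>2 - 2 * ((x - y) \<bullet> d) + (norm d)\<^sup>2"
    unfolding power2_norm_eq_inner by (simp add: inner_simps inner_commute)
  then show ?thesis
    using eta_pos by (simp add: joint_weight_def diff_divide_distrib add_divide_distrib flip: exp_add)
qed

text \<open>The left-hand side is the derivative of \<open>ln Z\<close> at \<open>y\<close> in direction \<open>d\<close>, so this is the tangent
inequality of the concave function \<open>ln Z\<close>. Instead of differentiating under the integral, Jensen's
inequality bounds the derivative by a difference quotient with step \<open>\<theta>\<close>, up to an error of order \<open>\<theta>\<close>,
and concavity compares the quotients over \<open>[y, y + \<theta> d]\<close> and \<open>[y - d, y]\<close>.\<close>

lemma ln_Z_tangent:
  "(LINT x|Q y. (x - y) \<bullet> d) / \<eta> \<le> ln (Z y) - ln (Z (y - d))"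
proof (rule field_le_epsilon)
  let ?m = "(LINT x|Q y. (x - y) \<bullet> d) / \<eta>"
  let ?K = "(norm d)\<^sup>2 / (2 * \<eta>)"
  interpret prob_space "Q y" by (rule prob_space_Q)
  have K: "0 \<le> ?K" using eta_pos by simp
  fix e :: real assume "0 < e"
  define \<theta> where "\<theta> = e / (?K + 1)"
  have \<theta>: "0 < \<theta>" "\<theta> * ?K \<le> e"
  proof -
    show "0 < \<theta>" using K \<open>0 < e\<close> by (simp add: \<theta>_def)
    then have "\<theta> * ?K \<le> \<theta> * (?K + 1)" by (intro mult_left_mono) auto
    also have "\<dots> = e" using K by (simp add: \<theta>_def)
    finally show "\<theta> * ?K \<le> e" .
  qed
  let ?X = "\<lambda>x. (x - y) \<bullet> (\<theta> *\<^sub>R d) / \<eta> - (norm (\<theta> *\<^sub>R d))\<^sup>2 / (2 * \<eta>)"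
  have E: "Z y * expectation (\<lambda>x. exp (?X x)) = Z (y + \<theta> *\<^sub>R d)"
    unfolding Z_def[of "y + _"] w_shift by (subst integral_Q) auto
  have "expectation ?X \<le> ln (expectation (\<lambda>x. exp (?X x)))"
  proof (rule expectation_le_ln_expectation_exp)
    show "integrable (Q y) ?X"
      by (intro Bochner_Integration.integrable_diff integrable_divide_zero integrable_Q_linear) auto
    show "integrable (Q y) (\<lambda>x. exp (?X x))"
      using integrable_w[of "y + \<theta> *\<^sub>R d"] by (subst integrable_Q_iff) (simp_all add: w_shift)
  qed
  also have "expectation ?X = \<theta> * ?m - \<theta>\<^sup>2 * ?K"
    using integrable_Q_linear[of y d] prob_space
    by (subst Bochner_Integration.integral_diff) (auto simp: power_mult_distrib)
  also have "expectation (\<lambda>x. exp (?X x)) = Z (y + \<theta> *\<^sub>R d) / Z y"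
    using E Z_pos[of y] by (simp add: field_simps)
  also have "ln \<dots> = ln (Z (y + \<theta> *\<^sub>R d)) - ln (Z y)"
    using Z_pos[of y] Z_pos[of "y + \<theta> *\<^sub>R d"] by (simp add: ln_div)
  finally have up: "\<theta> * ?m - \<theta>\<^sup>2 * ?K \<le> ln (Z (y + \<theta> *\<^sub>R d)) - ln (Z y)" .
  \<comment> \<open>with this weight, y is the convex combination of y - d and y + \<theta> d\<close>
  define l where "l = 1 / (1 + \<theta>)"
  have l: "0 < l" "l < 1" and l': "1 - l = \<theta> * l" "l * (1 + \<theta>) = 1"
    using \<theta> by (auto simp: l_def field_simps)
  have pt: "(1 - l) *\<^sub>R (y - d) + l *\<^sub>R (y + \<theta> *\<^sub>R d) = y"
  proof -
    have "(1 - l) *\<^sub>R (y - d) + l *\<^sub>R (y + \<theta> *\<^sub>R d) = y + (\<theta> * l - (1 - l)) *\<^sub>R d"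
      by (simp add: algebra_simps)
    then show ?thesis using l' by simp
  qed
  have "l * (\<theta> * ln (Z (y - d)) + ln (Z (y + \<theta> *\<^sub>R d))) \<le> l * ((1 + \<theta>) * ln (Z y))"
  proof -
    have "l * (\<theta> * ln (Z (y - d)) + ln (Z (y + \<theta> *\<^sub>R d))) = (1 - l) * ln (Z (y - d)) + l * ln (Z (y + \<theta> *\<^sub>R d))"
      unfolding l'(1) by (simp add: algebra_simps)
    moreover have "l * ((1 + \<theta>) * ln (Z y)) = ln (Z y)"
      using l'(2) by (simp only: mult.assoc[symmetric] mult_1)
    ultimately show ?thesis
      using Z_log_concave[OF l, of "y - d" "y + \<theta> *\<^sub>R d"] unfolding pt by linarith
  qed
  then have "\<theta> * ln (Z (y - d)) + ln (Z (y + \<theta> *\<^sub>R d)) \<le> (1 + \<theta>) * ln (Z y)"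
    using l by simp
  with up have "\<theta> * ?m \<le> \<theta> * (ln (Z y) - ln (Z (y - d)) + \<theta> * ?K)"
    by (simp add: algebra_simps power2_eq_square)
  then have "?m \<le> ln (Z y) - ln (Z (y - d)) + \<theta> * ?K"
    using \<theta>(1) by (rule mult_left_le_imp_le)
  also have "\<dots> \<le> ln (Z y) - ln (Z (y - d)) + e" using \<theta>(2) by simp
  finally show "?m \<le> ln (Z y) - ln (Z (y - d)) + e" .
qed

text \<open>The Gibbs variational principle for the pair \<open>Q y\<close>, \<open>Q y'\<close>. The second term on the right dominates the
relative entropy of \<open>Q y\<close> with respect to \<open>Q y'\<close>: with \<open>d = y - y'\<close>, the logarithm of the density is
the linear function \<open>(x - y) \<bullet> d / \<eta>\<close> plus the constant \<open>?c\<close>, and \<open>ln_Z_tangent\<close> cancels the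
normalizing constants against the mean of the linear part.\<close>

lemma change_of_center:
  fixes g :: "'a \<Rightarrow> real"
  assumes [measurable]: "g \<in> borel_measurable borel" and B: "\<And>x. \<bar>g x\<bar> \<le> B"
  shows "(LINT x|Q y. g x) \<le> ln (LINT x|Q y'. exp (g x)) + (norm (y - y'))\<^sup>2 / (2 * \<eta>)"
proof -
  define d where "d = y - y'"
  have y': "y' = y + - d" by (simp add: d_def)
  interpret prob_space "Q y" by (rule prob_space_Q)
  let ?c = "(norm d)\<^sup>2 / (2 * \<eta>) - ln (Z y) + ln (Z y')"
  let ?X = "\<lambda>x. g x - ((x - y) \<bullet> d / \<eta> + ?c)"
  have wX: "w x y * exp (?X x) = Z y / Z y' * (w x y' * exp (g x))" for x
  proof -
    have "exp (?X x) = exp (g x) * exp ((x - y) \<bullet> (- d) / \<eta> - (norm (- d))\<^sup>2 / (2 * \<eta>)) * (exp (ln (Z y)) / exp (ln (Z y')))"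
      by (simp flip: exp_add exp_diff)
    then show ?thesis
      using Z_pos[of y] Z_pos[of y'] unfolding y' w_shift by (simp add: field_simps)
  qed
  have ig: "integrable (Q y) g" by (rule integrable_Q_bounded) (use B in auto)
  have "expectation ?X \<le> ln (expectation (\<lambda>x. exp (?X x)))"
  proof (rule expectation_le_ln_expectation_exp)
    show "integrable (Q y) ?X"
      by (intro Bochner_Integration.integrable_diff Bochner_Integration.integrable_add ig
        integrable_divide_zero integrable_Q_linear) auto
    have "integrable (Q y') (\<lambda>x. exp (g x))"
      by (rule integrable_Q_bounded[where B="exp B"]) (use B in \<open>auto simp: abs_le_iff\<close>)
    then show "integrable (Q y) (\<lambda>x. exp (?X x))"
      by (subst integrable_Q_iff) (simp_all only: wX, auto simp: integrable_Q_iff)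
  qed
  also have "expectation (\<lambda>x. exp (?X x)) = (LINT x|Q y'. exp (g x))"
  proof -
    have "Z y * expectation (\<lambda>x. exp (?X x)) = (LINT x|lborel. Z y / Z y' * (w x y' * exp (g x)))"
      by (subst integral_Q[symmetric]) (simp_all only: wX, auto)
    also have "\<dots> = Z y * (LINT x|Q y'. exp (g x))"
      using Z_pos[of y'] by (subst integral_mult_right_zero) (simp add: integral_Q)
    finally show ?thesis using Z_pos[of y] by simp
  qed
  also have "expectation ?X = expectation g - ((LINT x|Q y. (x - y) \<bullet> d) / \<eta> + ?c)"
    using ig integrable_Q_linear[of y d]
    using prob_space
    by (simp add: Bochner_Integration.integral_diff Bochner_Integration.integral_add del: inner_diff_left)
  finally show ?thesis
    using ln_Z_tangent[of y d] by (simp add: d_def)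
qed

text \<open>Maurey's argument for Talagrand's transport inequality. Prekopa--Leindler is applied to the weight
multiplied by \<open>exp (t \<phi>)\<close> and by \<open>exp (- s h)\<close>, where \<open>(1 - l) t = l s\<close>: the quadratic cost
relating \<open>\<phi>\<close> to \<open>h\<close> is then exactly compensated by the strong convexity of the potential, so the
unmodified weight can serve as the third function. Letting the mixing weight \<open>l\<close> be arbitrary is
essential, since the sharp constant is only reached as \<open>l \<rightarrow> 1\<close>.\<close>

lemma exponential_transport:
  fixes \<phi> h :: "'a \<Rightarrow> real"
  assumes [measurable]: "\<phi> \<in> borel_measurable borel" "h \<in> borel_measurable borel"
    and B: "\<And>x. \<bar>\<phi> x\<bar> \<le> B" "\<And>x. \<bar>h x\<bar> \<le> B"
    and c: "0 < c" and le: "\<And>u v. \<phi> u \<le> h v + c * (norm (u - v))\<^sup>2"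
    and l: "0 < l" "l < 1"
  defines "t \<equiv> l / (2 * \<eta> * c)"
  shows "ln (LINT x|Q y. exp (t * \<phi> x)) \<le> t * (LINT x|Q y. h x)"
proof -
  interpret prob_space "Q y" by (rule prob_space_Q)
  define s where "s = (1 - l) / (2 * \<eta> * c)"
  have ts: "(1 - l) * t = l * s" by (simp add: t_def s_def)
  have t0: "0 < t" and s0: "0 < s" using l c eta_pos by (auto simp: t_def s_def)
  have tc: "t * c = l / (2 * \<eta>)" using c by (simp add: t_def)
  have bnd: "\<bar>exp (a * g x)\<bar> \<le> exp (\<bar>a\<bar> * B)" if "\<And>x. \<bar>g x\<bar> \<le> B" for a x and g :: "'a \<Rightarrow> real"
  proof -
    have "a * g x \<le> \<bar>a\<bar> * \<bar>g x\<bar>" by (metis abs_ge_self abs_mult)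
    also have "\<dots> \<le> \<bar>a\<bar> * B" using that by (intro mult_left_mono) auto
    finally show ?thesis by simp
  qed
  have int\<phi>: "integrable (Q y) (\<lambda>x. exp (t * \<phi> x))"
    by (rule integrable_Q_bounded[OF _ bnd]) (use B in auto)
  have inth: "integrable (Q y) (\<lambda>x. exp (- s * h x))"
    by (rule integrable_Q_bounded[OF _ bnd]) (use B in auto)
  let ?F = "\<lambda>x. w x y * exp (t * \<phi> x)" and ?G = "\<lambda>x. w x y * exp (- s * h x)"
  have "ennreal ((LINT x|lborel. ?F x) powr (1 - l) * (LINT x|lborel. ?G x) powr l) \<le> (\<integral>\<^sup>+x. ennreal (w x y) \<partial>lborel)"
  proof (rule prekopa_leindler)
    fix u v :: 'a
    let ?m = "(1 - l) *\<^sub>R u + l *\<^sub>R v"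
    have f: "f ?m \<le> (1 - l) * f u + l * f v"
      using convex_onD[OF convex_f, of l u v] l by (simp add: add.commute)
    have eq: "?m - y = (1 - l) *\<^sub>R (u - y) + l *\<^sub>R (v - y)"
      by (simp add: algebra_simps)
    have q: "(norm (?m - y))\<^sup>2 / (2 * \<eta>) = (1 - l) * ((norm (u - y))\<^sup>2 / (2 * \<eta>)) + l * ((norm (v - y))\<^sup>2 / (2 * \<eta>))
        - (1 - l) * (t * c * (norm (u - v))\<^sup>2)"
      unfolding eq norm_sq_convex_combination tc using eta_pos by (simp add: field_simps)
    have "(1 - l) * (t * \<phi> u) - l * (s * h v) = (1 - l) * t * (\<phi> u - h v)"
      unfolding right_diff_distrib using ts by (simp add: mult.assoc[symmetric])
    also have "\<dots> \<le> (1 - l) * t * (c * (norm (u - v))\<^sup>2)"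
      using le[of u v] l t0 by (intro mult_left_mono) auto
    finally have "(- f u - (norm (u - y))\<^sup>2 / (2 * \<eta>) + t * \<phi> u) * (1 - l)
        + (- f v - (norm (v - y))\<^sup>2 / (2 * \<eta>) + - s * h v) * l
       \<le> - f ?m - (norm (?m - y))\<^sup>2 / (2 * \<eta>)"
      using f unfolding q by (simp add: algebra_simps)
    then show "ennreal (?F u powr (1 - l) * ?G v powr l) \<le> ennreal (w ?m y)"
      unfolding joint_weight_def exp_powr_real exp_add[symmetric]
      by (intro ennreal_leI) simp
  next
    show "integrable lborel ?F" using int\<phi> by (simp add: integrable_Q_iff)
    show "integrable lborel ?G" using inth by (simp add: integrable_Q_iff)
  qed (use w_pos[THEN less_imp_le] l in auto)
  also have "\<dots> = ennreal (Z y)"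
    unfolding Z_def using integrable_w w_pos[THEN less_imp_le] by (intro nn_integral_eq_integral) auto
  finally have PL: "(Z y * expectation (\<lambda>x. exp (t * \<phi> x))) powr (1 - l) * (Z y * expectation (\<lambda>x. exp (- s * h x))) powr l \<le> Z y"
    using Z_pos[of y] by (subst (asm) (1 2) integral_Q) auto
  have J: "0 < expectation (\<lambda>x. exp (r * g x)) \<and> r * expectation g \<le> ln (expectation (\<lambda>x. exp (r * g x)))"
    if [measurable]: "g \<in> borel_measurable borel" and g: "\<And>x. \<bar>g x\<bar> \<le> B" for r and g :: "'a \<Rightarrow> real"
  proof -
    have i: "integrable (Q y) (\<lambda>x. exp (r * g x))" "integrable (Q y) g"
      by (rule integrable_Q_bounded[OF _ bnd]; use g in auto) (rule integrable_Q_bounded; use g in auto)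
    have "exp (expectation (\<lambda>x. r * g x)) \<le> expectation (\<lambda>x. exp (r * g x))"
      using i by (intro exp_expectation_le) auto
    then have "0 < expectation (\<lambda>x. exp (r * g x))" by (metis exp_gt_zero less_le_trans)
    moreover have "expectation (\<lambda>x. r * g x) \<le> ln (expectation (\<lambda>x. exp (r * g x)))"
      using i by (intro expectation_le_ln_expectation_exp) auto
    ultimately show ?thesis by simp
  qed
  let ?a = "expectation (\<lambda>x. exp (t * \<phi> x))" and ?b = "expectation (\<lambda>x. exp (- s * h x))"
  have a: "0 < ?a" and b: "0 < ?b" "- s * expectation h \<le> ln ?b"
    using J[of \<phi> t] J[of h "- s"] B by auto
  have "ln ((Z y * ?a) powr (1 - l) * (Z y * ?b) powr l) \<le> ln (Z y)"
    using PL a b Z_pos[of y] by (intro ln_mono) auto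
  then have "(1 - l) * ln ?a + l * ln ?b \<le> 0"
    using a b Z_pos[of y] by (simp add: ln_mult ln_powr algebra_simps)
  moreover have "l * (- s * expectation h) \<le> l * ln ?b"
    using b l by (intro mult_left_mono) auto
  moreover have "(1 - l) * (t * expectation h) = - (l * (- s * expectation h))"
    using ts by (simp add: mult.assoc[symmetric])
  ultimately have "(1 - l) * ln ?a \<le> (1 - l) * (t * expectation h)"
    by linarith
  then show ?thesis using l by simp
qed

text \<open>The dual form of \<open>W\<^sub>2 (Q y, Q y') \<le> \<parallel>y - y'\<parallel>\<close>. Change of centre and exponential transport combine to the
claim with an additional factor \<open>1 / l\<close> on the right, and \<open>l < 1\<close> is arbitrary. It matters that the
constant is exactly 1: any loss would accumulate geometrically over the iterations.\<close>

lemma Q_contraction: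
  fixes \<phi> h :: "'a \<Rightarrow> real"
  assumes [measurable]: "\<phi> \<in> borel_measurable borel" "h \<in> borel_measurable borel"
    and B: "\<And>x. \<bar>\<phi> x\<bar> \<le> B" "\<And>x. \<bar>h x\<bar> \<le> B"
    and c: "0 < c" and le: "\<And>u v. \<phi> u \<le> h v + c * (norm (u - v))\<^sup>2"
  shows "(LINT x|Q y. \<phi> x) \<le> (LINT x|Q y'. h x) + c * (norm (y - y'))\<^sup>2"
proof -
  have "(LINT x|Q y. \<phi> x) - (LINT x|Q y'. h x) \<le> c * (norm (y - y'))\<^sup>2"
  proof (rule field_le_mult_one_interval)
    fix l :: real assume l: "0 < l" "l < 1"
    define t where "t = l / (2 * \<eta> * c)"
    have t: "0 < t" using l c eta_pos by (simp add: t_def)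
    have "\<bar>t * \<phi> x\<bar> \<le> t * B" for x
      using B(1)[of x] t by (simp add: abs_mult)
    then have "(LINT x|Q y. t * \<phi> x) \<le> ln (LINT x|Q y'. exp (t * \<phi> x)) + (norm (y - y'))\<^sup>2 / (2 * \<eta>)"
      by (intro change_of_center) auto
    also have "\<dots> \<le> t * (LINT x|Q y'. h x) + (norm (y - y'))\<^sup>2 / (2 * \<eta>)"
      unfolding t_def using B c le l by (intro add_right_mono exponential_transport) auto
    finally have "t * ((LINT x|Q y. \<phi> x) - (LINT x|Q y'. h x)) \<le> (norm (y - y'))\<^sup>2 / (2 * \<eta>)"
      by (simp add: right_diff_distrib)
    then have "(2 * \<eta> * c) * (t * ((LINT x|Q y. \<phi> x) - (LINT x|Q y'. h x))) \<le> (2 * \<eta> * c) * ((norm (y - y'))\<^sup>2 / (2 * \<eta>))"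
      using c eta_pos by (intro mult_left_mono) auto
    then show "l * ((LINT x|Q y. \<phi> x) - (LINT x|Q y'. h x)) \<le> c * (norm (y - y'))\<^sup>2"
      using c eta_pos by (simp add: t_def)
  qed
  then show ?thesis by simp
qed

end

section \<open>The Gaussian forward step\<close>

lemma lborel_integral_affine:
  fixes g :: "'a::euclidean_space \<Rightarrow> real"
  assumes [measurable]: "g \<in> borel_measurable borel" and c: "\<bar>c\<bar> = 1"
  shows "(LINT x|lborel. g (t + c *\<^sub>R x)) = (LINT x|lborel. g x)"
proof -
  have "c \<noteq> 0" using c by auto
  from lborel_affine[OF this, of t] have "lborel = distr lborel borel (\<lambda>x::'a. t + c *\<^sub>R x)"
    using c by (simp add: density_1)
  then have "(LINT x|lborel. g x) = (LINT x|distr lborel borel (\<lambda>x. t + c *\<^sub>R x). g x)" by simp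
  also have "\<dots> = (LINT x|lborel. g (t + c *\<^sub>R x))" by (subst integral_distr) auto
  finally show ?thesis ..
qed

definition gaussian_density :: "real \<Rightarrow> 'a::euclidean_space \<Rightarrow> 'a \<Rightarrow> real" where
  "gaussian_density \<tau> x y = exp (- (norm (y - x))\<^sup>2 / (2 * \<tau>)) / sqrt (2 * pi * \<tau>) ^ DIM('a)"

lemma measurable_gaussian_density [measurable]:
  "(\<lambda>(x, y). gaussian_density \<tau> x y) \<in> borel_measurable (borel \<Otimes>\<^sub>M borel)"
  unfolding gaussian_density_def by measurable

lemma gaussian_eq: "gaussian x \<tau> = density lborel (\<lambda>y. ennreal (gaussian_density \<tau> x y))"
  by (simp add: gaussian_def gaussian_density_def)

lemma sets_gaussian [simp, measurable_cong]: "sets (gaussian x \<tau>) = sets borel"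
  and space_gaussian [simp]: "space (gaussian x \<tau>) = UNIV"
  by (simp_all add: gaussian_def)

context
  fixes \<tau> :: real
  assumes \<tau>: "0 < \<tau>"
begin

lemma gaussian_density_pos: "0 < gaussian_density \<tau> x y"
  using \<tau> by (simp add: gaussian_density_def)

lemma nn_integral_gaussian_density:
  "(\<integral>\<^sup>+y. gaussian_density \<tau> x y \<partial>(lborel :: 'a::euclidean_space measure)) = 1"
proof -
  have prod: "gaussian_density \<tau> x y = (\<Prod>b\<in>Basis. normal_density (x \<bullet> b) (sqrt \<tau>) (y \<bullet> b))" for y :: 'a
  proof -
    have "(norm (y - x))\<^sup>2 = (\<Sum>b\<in>Basis. (y \<bullet> b - x \<bullet> b)\<^sup>2)"
      unfolding power2_norm_eq_inner by (subst euclidean_inner) (simp add: inner_diff_left power2_eq_square)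
    then show ?thesis
      using \<tau> by (simp add: gaussian_density_def normal_density_def prod_dividef prod.distrib exp_sum
        sum_divide_distrib real_sqrt_mult flip: sum_negf)
  qed
  have "(\<integral>\<^sup>+y. gaussian_density \<tau> x y \<partial>lborel) = (\<integral>\<^sup>+y. (\<Prod>b\<in>Basis. ennreal (normal_density (x \<bullet> b) (sqrt \<tau>) (y \<bullet> b))) \<partial>lborel)"
    by (simp add: prod prod_ennreal)
  also have "\<dots> = (\<Prod>b\<in>(Basis::'a set). (\<integral>\<^sup>+y. ennreal (normal_density (x \<bullet> b) (sqrt \<tau>) y) \<partial>lborel))"
    by (rule nn_integral_lborel_prod) auto
  also have "\<dots> = 1"
    using \<tau> by (intro prod.neutral) (auto simp: nn_integral_eq_integral)
  finally show ?thesis .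
qed

lemma prob_space_gaussian: "prob_space (gaussian x \<tau>)"
proof
  show "emeasure (gaussian x \<tau>) (space (gaussian x \<tau>)) = 1"
    by (simp add: gaussian_eq emeasure_density nn_integral_gaussian_density)
qed

lemma integrable_gaussian_density: "integrable lborel (gaussian_density \<tau> x)"
  using gaussian_density_pos[of x, THEN less_imp_le] nn_integral_gaussian_density[of x]
  by (intro integrableI_nonneg) auto

lemma integral_gaussian:
  fixes g :: "'a::euclidean_space \<Rightarrow> real"
  assumes [measurable]: "g \<in> borel_measurable borel"
  shows "(LINT y|gaussian x \<tau>. g y) = (LINT y|lborel. gaussian_density \<tau> x y * g y)"
  using gaussian_density_pos[of x, THEN less_imp_le] by (simp add: gaussian_eq integral_density)

lemma integrable_gaussian_iff:
  fixes g :: "'a::euclidean_space \<Rightarrow> real"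
  assumes [measurable]: "g \<in> borel_measurable borel"
  shows "integrable (gaussian x \<tau>) g \<longleftrightarrow> integrable lborel (\<lambda>y. gaussian_density \<tau> x y * g y)"
  using gaussian_density_pos[of x, THEN less_imp_le] by (simp add: gaussian_eq integrable_density)

lemma integral_gaussian_translate:
  fixes g :: "'a::euclidean_space \<Rightarrow> real"
  assumes [measurable]: "g \<in> borel_measurable borel"
  shows "(LINT y|gaussian x \<tau>. g (y + d)) = (LINT y|gaussian (x + d) \<tau>. g y)"
proof -
  have "(LINT y|gaussian (x + d) \<tau>. g y) = (LINT y|lborel. gaussian_density \<tau> (x + d) (d + 1 *\<^sub>R y) * g (d + 1 *\<^sub>R y))"
    by (subst lborel_integral_affine) (auto simp: integral_gaussian)
  also have "\<dots> = (LINT y|lborel. gaussian_density \<tau> x y * g (y + d))"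
    by (simp add: gaussian_density_def algebra_simps)
  finally show ?thesis by (simp add: integral_gaussian)
qed

end

text \<open>The mean of the linear function vanishes by reflection at \<open>x\<close>; integrability follows by comparison
with a Gaussian of twice the variance.\<close>

lemma gaussian_mean:
  assumes \<tau>: "0 < \<tau>"
  shows "integrable (gaussian x \<tau>) (\<lambda>y. (y - x) \<bullet> d)" "(LINT y|gaussian x \<tau>. (y - x) \<bullet> d) = 0"
proof -
  let ?C = "sqrt (2 * pi * \<tau>) ^ DIM('a)" and ?C2 = "sqrt (2 * pi * (2 * \<tau>)) ^ DIM('a)"
  have "integrable lborel (\<lambda>y. gaussian_density \<tau> x y * ((y - x) \<bullet> d))"
  proof (rule Bochner_Integration.integrable_bound)
    show "integrable lborel (\<lambda>y. ((1 + 2 * \<tau>) * norm d * ?C2 / ?C) * gaussian_density (2 * \<tau>) x y)"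
      using integrable_gaussian_density[of "2 * \<tau>" x] \<tau> by simp
    have "norm (gaussian_density \<tau> x y * ((y - x) \<bullet> d)) \<le> norm (((1 + 2 * \<tau>) * norm d * ?C2 / ?C) * gaussian_density (2 * \<tau>) x y)" for y
    proof -
      let ?r = "norm (y - x)" and ?e = "exp (- (norm (y - x))\<^sup>2 / (2 * (2 * \<tau>)))"
      have "?r * ?e \<le> 1 + 2 * \<tau>"
        using le_exp_square[of "2 * \<tau>" ?r] \<tau> by (simp add: exp_minus field_simps)
      have sq: "exp (- ?r\<^sup>2 / (2 * \<tau>)) = ?e * ?e"
        using \<tau> by (simp add: field_simps flip: exp_add)
      have "norm (gaussian_density \<tau> x y * ((y - x) \<bullet> d)) = (?e * ?e) / ?C * \<bar>(y - x) \<bullet> d\<bar>"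
        using \<tau> unfolding gaussian_density_def sq by (simp add: abs_mult)
      also have "\<dots> \<le> (?e * ?e) / ?C * (?r * norm d)"
        using \<tau> by (intro mult_left_mono Cauchy_Schwarz_ineq2) auto
      also have "\<dots> = (?r * ?e) * (?e * norm d / ?C)" by simp
      also have "\<dots> \<le> (1 + 2 * \<tau>) * (?e * norm d / ?C)"
        using \<tau> \<open>?r * ?e \<le> 1 + 2 * \<tau>\<close> by (intro mult_right_mono) auto
      also have "\<dots> = norm (((1 + 2 * \<tau>) * norm d * ?C2 / ?C) * gaussian_density (2 * \<tau>) x y)"
        using \<tau> unfolding gaussian_density_def by (simp add: abs_mult)
      finally show ?thesis .
    qed
    then show "AE y in lborel. norm (gaussian_density \<tau> x y * ((y - x) \<bullet> d)) \<le> norm (((1 + 2 * \<tau>) * norm d * ?C2 / ?C) * gaussian_density (2 * \<tau>) x y)"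
      by simp
  qed simp
  then show "integrable (gaussian x \<tau>) (\<lambda>y. (y - x) \<bullet> d)"
    using \<tau> by (simp add: integrable_gaussian_iff)
  have "(LINT y|gaussian x \<tau>. (y - x) \<bullet> d) = (LINT y|lborel. gaussian_density \<tau> x (2 *\<^sub>R x + (-1) *\<^sub>R y) * ((2 *\<^sub>R x + (-1) *\<^sub>R y - x) \<bullet> d))"
    using \<tau> by (subst lborel_integral_affine) (auto simp: integral_gaussian)
  also have "\<dots> = (LINT y|lborel. - (gaussian_density \<tau> x y * ((y - x) \<bullet> d)))"
  proof -
    have e: "2 *\<^sub>R x + (-1) *\<^sub>R y - x = - (y - x)" for y by (simp add: scaleR_2)
    show ?thesis
      unfolding gaussian_density_def e norm_minus_cancel inner_minus_left by simp
  qed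
  also have "\<dots> = - (LINT y|gaussian x \<tau>. (y - x) \<bullet> d)"
    using \<tau> by (simp add: integral_gaussian)
  finally show "(LINT y|gaussian x \<tau>. (y - x) \<bullet> d) = 0" by simp
qed

text \<open>The Gibbs variational principle, with \<open>\<parallel>x - x'\<parallel>\<^sup>2 / (2 \<tau>)\<close> the relative entropy of the two Gaussians.\<close>

lemma gaussian_log_harnack:
  fixes g :: "'a::euclidean_space \<Rightarrow> real"
  assumes \<tau>: "0 < \<tau>"
    and [measurable]: "g \<in> borel_measurable borel" and g: "\<And>x. 1 \<le> g x" "\<And>x. g x \<le> b"
  shows "(LINT y|gaussian x \<tau>. ln (g y)) \<le> ln (LINT y|gaussian x' \<tau>. g y) + (norm (x - x'))\<^sup>2 / (2 * \<tau>)"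
proof -
  interpret prob_space "gaussian x \<tau>" using \<tau> by (rule prob_space_gaussian)
  interpret G': prob_space "gaussian x' \<tau>" using \<tau> by (rule prob_space_gaussian)
  define d where "d = x' - x"
  let ?K = "(norm d)\<^sup>2 / (2 * \<tau>)"
  let ?X = "\<lambda>y. ln (g y) + ((y - x) \<bullet> d / \<tau> - ?K)"
  have pos: "0 < g y" for y using g(1)[of y] by simp
  have tilt: "gaussian_density \<tau> x y * exp (?X y) = gaussian_density \<tau> x' y * g y" for y
  proof -
    have "(norm (y - x'))\<^sup>2 = (norm (y - x))\<^sup>2 - 2 * ((y - x) \<bullet> d) + (norm d)\<^sup>2"
      unfolding power2_norm_eq_inner by (simp add: d_def inner_simps inner_commute)
    then have "exp (- (norm (y - x))\<^sup>2 / (2 * \<tau>)) * exp ((y - x) \<bullet> d / \<tau> - ?K) = exp (- (norm (y - x'))\<^sup>2 / (2 * \<tau>))"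
      using \<tau> by (simp add: add_divide_distrib diff_divide_distrib flip: exp_add)
    then show ?thesis
      using pos[of y] by (simp add: gaussian_density_def exp_add)
  qed
  have int_ln: "integrable (gaussian x \<tau>) (\<lambda>y. ln (g y))"
    by (rule integrable_const_bound[where B="ln b"]) (use g pos in \<open>auto intro!: ln_mono\<close>)
  have int_g: "integrable (gaussian x' \<tau>) g"
    by (rule G'.integrable_const_bound[where B=b]) (use g pos in \<open>auto simp: less_imp_le\<close>)
  have "expectation ?X \<le> ln (expectation (\<lambda>y. exp (?X y)))"
  proof (rule expectation_le_ln_expectation_exp)
    show "integrable (gaussian x \<tau>) ?X"
      by (intro Bochner_Integration.integrable_diff Bochner_Integration.integrable_add int_ln
        integrable_divide_zero gaussian_mean \<tau>) auto
    show "integrable (gaussian x \<tau>) (\<lambda>y. exp (?X y))"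
      using int_g \<tau> by (subst integrable_gaussian_iff) (simp_all only: tilt integrable_gaussian_iff, auto simp: integrable_gaussian_iff)
  qed
  also have "expectation (\<lambda>y. exp (?X y)) = (LINT y|gaussian x' \<tau>. g y)"
    using \<tau> by (subst integral_gaussian) (simp_all only: tilt, auto simp: integral_gaussian)
  also have "expectation ?X = expectation (\<lambda>y. ln (g y)) - ?K"
    using int_ln gaussian_mean[OF \<tau>, of x d] prob_space
    by (simp add: Bochner_Integration.integral_diff Bochner_Integration.integral_add del: inner_diff_left)
  finally show ?thesis by (simp add: d_def norm_minus_commute)
qed

section \<open>The log-Harnack inequality\<close>

context proximal_sampler
begin

abbreviation G :: "'a \<Rightarrow> 'a measure" where "G \<equiv> cond_Y_given_X \<eta>"

lemma G_eq: "G x = gaussian x \<eta>"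
  by (simp add: cond_Y_given_X_def)

lemma measurable_Z [measurable]: "Z \<in> borel_measurable borel"
  unfolding Z_def[abs_def] by measurable

lemma measurable_Q [measurable]: "Q \<in> borel \<rightarrow>\<^sub>M subprob_algebra borel"
proof (rule measurable_subprob_algebra)
  fix A :: "'a set" assume [measurable]: "A \<in> sets borel"
  have "(\<lambda>y. emeasure (Q y) A) = (\<lambda>y. \<integral>\<^sup>+x. ennreal (w x y / Z y) * indicator A x \<partial>lborel)"
    by (simp add: Q_eq emeasure_density)
  also have "\<dots> \<in> borel_measurable borel" by measurable
  finally show "(\<lambda>y. emeasure (Q y) A) \<in> borel_measurable borel" .
qed (auto intro: prob_space_imp_subprob_space prob_space_Q)

lemma measurable_G [measurable]: "G \<in> borel \<rightarrow>\<^sub>M subprob_algebra borel"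
proof (rule measurable_subprob_algebra)
  fix A :: "'a set" assume [measurable]: "A \<in> sets borel"
  have "(\<lambda>x. emeasure (G x) A) = (\<lambda>x. \<integral>\<^sup>+y. ennreal (gaussian_density \<eta> x y) * indicator A y \<partial>lborel)"
    by (simp add: G_eq gaussian_eq emeasure_density)
  also have "\<dots> \<in> borel_measurable borel" by measurable
  finally show "(\<lambda>x. emeasure (G x) A) \<in> borel_measurable borel" .
qed (auto simp: G_eq intro: prob_space_imp_subprob_space prob_space_gaussian eta_pos)

definition P :: "('a \<Rightarrow> real) \<Rightarrow> 'a \<Rightarrow> real" where
  "P g x = (LINT y|G x. LINT x'|Q y. g x')"

lemma integral_Q_bounds:
  fixes g :: "'a \<Rightarrow> real"
  assumes [measurable]: "g \<in> borel_measurable borel" and g: "\<And>x. a \<le> g x" "\<And>x. g x \<le> b"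
  shows "(\<lambda>y. LINT x|Q y. g x) \<in> borel_measurable borel"
    "a \<le> (LINT x|Q y. g x)" "(LINT x|Q y. g x) \<le> b"
proof -
  interpret prob_space "Q y" by (rule prob_space_Q)
  have "\<bar>g x\<bar> \<le> max \<bar>a\<bar> \<bar>b\<bar>" for x using g[of x] by linarith
  then have "integrable (Q y) g" by (intro integrable_Q_bounded) auto
  then show "a \<le> (LINT x|Q y. g x)" "(LINT x|Q y. g x) \<le> b"
    using g by (auto intro!: integral_ge_const integral_le_const)
  show "(\<lambda>y. LINT x|Q y. g x) \<in> borel_measurable borel"
    by (rule measurable_compose[OF measurable_Q integral_measurable_subprob_algebra]) simp
qed

lemma integral_G_bounds:
  fixes g :: "'a \<Rightarrow> real"
  assumes [measurable]: "g \<in> borel_measurable borel" and g: "\<And>x. a \<le> g x" "\<And>x. g x \<le> b"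
  shows "(\<lambda>x. LINT y|G x. g y) \<in> borel_measurable borel"
    "a \<le> (LINT y|G x. g y)" "(LINT y|G x. g y) \<le> b" "integrable (G x) g"
proof -
  interpret prob_space "G x" unfolding G_eq using eta_pos by (rule prob_space_gaussian)
  have "\<bar>g x\<bar> \<le> max \<bar>a\<bar> \<bar>b\<bar>" for x using g[of x] by linarith
  then show "integrable (G x) g"
    by (intro integrable_const_bound[where B="max \<bar>a\<bar> \<bar>b\<bar>"]) (auto simp: G_eq)
  then show "a \<le> (LINT y|G x. g y)" "(LINT y|G x. g y) \<le> b"
    using g by (auto intro!: integral_ge_const integral_le_const)
  show "(\<lambda>x. LINT y|G x. g y) \<in> borel_measurable borel"
    by (rule measurable_compose[OF measurable_G integral_measurable_subprob_algebra]) simp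
qed

lemma P_bounds:
  assumes "g \<in> borel_measurable borel" "\<And>x. a \<le> g x" "\<And>x. g x \<le> b"
  shows "P g \<in> borel_measurable borel" "a \<le> P g x" "P g x \<le> b"
proof -
  note q = integral_Q_bounds[OF assms]
  show "P g \<in> borel_measurable borel" "a \<le> P g x" "P g x \<le> b"
    unfolding P_def[abs_def] using integral_G_bounds[OF q] by simp_all
qed

lemma P_funpow_bounds:
  assumes "g \<in> borel_measurable borel" "\<And>x. a \<le> g x" "\<And>x. g x \<le> b"
  shows "(P ^^ n) g \<in> borel_measurable borel \<and> (\<forall>x. a \<le> (P ^^ n) g x \<and> (P ^^ n) g x \<le> b)"
proof (induction n)
  case 0
  then show ?case using assms by simp
next
  case (Suc n)
  then show ?case using P_bounds[of "(P ^^ n) g" a b] by simp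
qed

text \<open>The hypothesis compares \<open>A\<close> and \<open>B\<close> at points a fixed displacement \<open>d\<close> apart, as when two copies of the
chain are driven by the same Gaussian noise from \<open>x\<close> and \<open>x + d\<close>. The remaining displacement from
\<open>x + d\<close> to \<open>x'\<close> is paid for in entropy.\<close>

lemma shifted_gaussian_step:
  fixes A B :: "'a \<Rightarrow> real"
  assumes [measurable]: "A \<in> borel_measurable borel" "B \<in> borel_measurable borel"
    and A: "\<And>y. 0 \<le> A y" "\<And>y. A y \<le> a" and B: "\<And>y. 1 \<le> B y" "\<And>y. B y \<le> b"
    and le: "\<And>y. A y \<le> ln (B (y + d)) + K"
  shows "(LINT y|G x. A y) \<le> ln (LINT y|G x'. B y) + K + (norm (x + d - x'))\<^sup>2 / (2 * \<eta>)"
proof -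
  interpret prob_space "G x" unfolding G_eq using eta_pos by (rule prob_space_gaussian)
  have pos: "0 < B y" for y using B(1)[of y] by simp
  have int_ln: "integrable (G x) (\<lambda>y. ln (B (y + d)))"
    by (rule integral_G_bounds[where a=0 and b="ln b"]) (use B pos in \<open>auto intro!: ln_mono\<close>)
  have "(LINT y|G x. A y) \<le> (LINT y|G x. ln (B (y + d)) + K)"
    using le int_ln by (intro integral_mono integral_G_bounds(4)[OF _ A] Bochner_Integration.integrable_add) auto
  also have "\<dots> = (LINT y|G x. ln (B (y + d))) + K"
    using int_ln prob_space by simp
  also have "(LINT y|G x. ln (B (y + d))) = (LINT y|G (x + d). ln (B y))"
    unfolding G_eq using eta_pos by (intro integral_gaussian_translate) auto
  also have "\<dots> \<le> ln (LINT y|G x'. B y) + (norm (x + d - x'))\<^sup>2 / (2 * \<eta>)"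
    unfolding G_eq using eta_pos B by (intro gaussian_log_harnack) auto
  finally show ?thesis by simp
qed

text \<open>Run the first step from \<open>x\<close> and from \<open>x + d\<close>, where \<open>d = (1 - s) (x' - x)\<close>, with the same noise. The gap
\<open>d\<close> persists in \<open>y\<close>, the backward step does not enlarge it, and the induction hypothesis charges
\<open>(1 - s)\<^sup>2 / (2 n \<eta>)\<close> for it; the displacement from \<open>x + d\<close> to \<open>x'\<close> costs entropy \<open>s\<^sup>2 / (2 \<eta>)\<close>, both times
\<open>\<parallel>x - x'\<parallel>\<^sup>2\<close>. The sum is minimal for \<open>s = 1 / (n + 1)\<close>, with value \<open>1 / (2 (n + 1) \<eta>)\<close>. For a single
step the displacement is the whole gap.\<close>

theorem log_harnack:
  fixes g :: "'a \<Rightarrow> real"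
  assumes g [measurable]: "g \<in> borel_measurable borel" and g1: "\<And>x. 1 \<le> g x" and gb: "\<And>x. g x \<le> b"
  shows "(P ^^ Suc m) (\<lambda>x. ln (g x)) x \<le> ln ((P ^^ Suc m) g x') + (norm (x - x'))\<^sup>2 / (2 * (real m + 1) * \<eta>)"
proof (induction m arbitrary: x x')
  have pos: "0 < g x" for x using g1[of x] by simp
  have ln_g: "(\<lambda>x. ln (g x)) \<in> borel_measurable borel" "\<And>x. 0 \<le> ln (g x)" "\<And>x. ln (g x) \<le> ln b"
    using g1 gb pos by (auto intro!: ln_mono)
  {
    case 0
    have "(LINT x|Q y. ln (g x)) \<le> ln (LINT x|Q y. g x)" for y
    proof -
      interpret prob_space "Q y" by (rule prob_space_Q)
      show ?thesis using g1 gb by (intro expectation_ln_le) auto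
    qed
    then have "P (\<lambda>x. ln (g x)) x \<le> ln (P g x') + 0 + (norm (x + 0 - x'))\<^sup>2 / (2 * \<eta>)"
      unfolding P_def
      by (intro shifted_gaussian_step[where a="ln b" and b=b] integral_Q_bounds[OF ln_g] integral_Q_bounds[OF g g1 gb]) auto
    then show ?case by simp
  next
    case (Suc m)
    let ?\<phi> = "(P ^^ Suc m) (\<lambda>x. ln (g x))" and ?\<psi> = "(P ^^ Suc m) g"
    define c where "c = 1 / (2 * (real m + 1) * \<eta>)"
    define s where "s = 1 / (real m + 2)"
    define d where "d = (1 - s) *\<^sub>R (x' - x)"
    have c: "0 < c" using eta_pos by (simp add: c_def)
    have \<phi>: "?\<phi> \<in> borel_measurable borel" "\<And>x. 0 \<le> ?\<phi> x" "\<And>x. ?\<phi> x \<le> ln b"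
      using P_funpow_bounds[OF ln_g, of "Suc m"] by auto
    have \<psi>: "?\<psi> \<in> borel_measurable borel" "\<And>x. 1 \<le> ?\<psi> x" "\<And>x. ?\<psi> x \<le> b"
      using P_funpow_bounds[OF g g1 gb, of "Suc m"] by auto
    have \<psi>pos: "0 < ?\<psi> x" for x using \<psi>(2)[of x] by linarith
    have ln_\<psi>: "\<bar>ln (?\<psi> x)\<bar> \<le> ln b" for x
      using \<psi>(2,3)[of x] \<psi>pos[of x] by (auto intro!: ln_mono)
    have "(LINT u|Q y. ?\<phi> u) \<le> ln (LINT v|Q (y + d). ?\<psi> v) + c * (norm d)\<^sup>2" for y
    proof -
      interpret Q': prob_space "Q (y + d)" by (rule prob_space_Q)
      have "(LINT u|Q y. ?\<phi> u) \<le> (LINT v|Q (y + d). ln (?\<psi> v)) + c * (norm (y - (y + d)))\<^sup>2"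
      proof (rule Q_contraction[where B="ln b"])
        show "?\<phi> u \<le> ln (?\<psi> v) + c * (norm (u - v))\<^sup>2" for u v
          using Suc.IH[of u v] by (simp add: c_def)
        show "(\<lambda>x. ln (?\<psi> x)) \<in> borel_measurable borel" using \<psi>(1) by measurable
        show "\<bar>?\<phi> x\<bar> \<le> ln b" for x using \<phi>(2,3)[of x] by simp
      qed (use \<phi>(1) ln_\<psi> c in auto)
      also have "(LINT v|Q (y + d). ln (?\<psi> v)) \<le> ln (LINT v|Q (y + d). ?\<psi> v)"
        using \<psi> by (intro Q'.expectation_ln_le) auto
      finally show ?thesis by simp
    qed
    then have "(LINT y|G x. LINT u|Q y. ?\<phi> u) \<le> ln (LINT y|G x'. LINT v|Q y. ?\<psi> v) + c * (norm d)\<^sup>2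
        + (norm (x + d - x'))\<^sup>2 / (2 * \<eta>)"
      by (intro shifted_gaussian_step[where a="ln b" and b=b] integral_Q_bounds[OF \<phi>] integral_Q_bounds[OF \<psi>]) auto
    moreover have "c * (norm d)\<^sup>2 + (norm (x + d - x'))\<^sup>2 / (2 * \<eta>) = (norm (x - x'))\<^sup>2 / (2 * (real (Suc m) + 1) * \<eta>)"
    proof -
      have "x + d - x' = s *\<^sub>R (x - x')" by (simp add: d_def algebra_simps)
      moreover have "(norm d)\<^sup>2 = (1 - s)\<^sup>2 * (norm (x - x'))\<^sup>2"
        by (simp add: d_def power_mult_distrib norm_minus_commute)
      moreover have "c * (1 - s)\<^sup>2 + s\<^sup>2 / (2 * \<eta>) = 1 / (2 * (real m + 2) * \<eta>)"
      proof -
        have s: "1 - s = (real m + 1) * s" "s * (real m + 2) = 1" by (simp_all add: s_def field_simps)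
        have "c * (1 - s)\<^sup>2 = (c * (real m + 1)) * ((real m + 1) * s\<^sup>2)"
          unfolding s(1) by (simp add: power2_eq_square)
        also have "c * (real m + 1) = 1 / (2 * \<eta>)"
        proof -
          have "1 / (2 * q * \<eta>) * q = 1 / (2 * \<eta>)" if "0 < q" for q using that by simp
          from this[of "real m + 1"] show ?thesis unfolding c_def by simp
        qed
        finally have "c * (1 - s)\<^sup>2 + s\<^sup>2 / (2 * \<eta>) = (s * (real m + 2)) * s / (2 * \<eta>)"
          by (simp add: power2_eq_square algebra_simps flip: add_divide_distrib)
        then show ?thesis unfolding s(2) by (simp add: s_def)
      qed
      moreover have "c * ((1 - s)\<^sup>2 * N) + s\<^sup>2 * N / (2 * \<eta>) = (c * (1 - s)\<^sup>2 + s\<^sup>2 / (2 * \<eta>)) * N" for N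
        by (simp add: algebra_simps)
      ultimately show ?thesis
        by (simp add: power_mult_distrib add.commute)
    qed
    moreover have "(P ^^ Suc (Suc m)) h z = (LINT y|G z. LINT u|Q y. (P ^^ Suc m) h u)" for h z
      by (subst funpow.simps(2)) (simp only: o_apply P_def[of "(P ^^ Suc m) h"])
    ultimately show ?case by (simp only: add.assoc)
  }
qed

end

section \<open>From log-moment bounds to relative entropy\<close>

text \<open>One half of the Donsker--Varadhan formula. Testing with exponentials of multiples of the indicator of a
null set shows absolute continuity. Testing with the density \<open>r\<close> clipped to \<open>[1/N, N]\<close>, and scaled by
\<open>N\<close> so that it is at least 1, bounds the integral of its logarithm by \<open>C + 1/N\<close>, since clipping
raises the mass by at most \<open>1/N\<close>. The negative part of \<open>ln r\<close> is always integrable because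
\<open>r ln (1/r) \<le> 1\<close>; with this, monotone convergence gives integrability of the positive part, and
dominated convergence removes the clipping.\<close>

lemma KL_le_of_dual_bound:
  fixes \<pi> \<rho> :: "'a measure"
  assumes "prob_space \<pi>" "prob_space \<rho>" and sets: "sets \<rho> = sets \<pi>"
    and dual: "\<And>g b. g \<in> borel_measurable \<pi> \<Longrightarrow> (\<And>x. 1 \<le> g x) \<Longrightarrow> (\<And>x. g x \<le> b) \<Longrightarrow>
      (LINT x|\<rho>. ln (g x)) \<le> ln (LINT x|\<pi>. g x) + C"
  shows "KL \<pi> \<rho> \<le> ereal C"
proof -
  interpret \<pi>: prob_space \<pi> by fact
  interpret \<rho>: prob_space \<rho> by fact
  note sets [measurable_cong]
  have ac: "absolutely_continuous \<pi> \<rho>"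
    unfolding absolutely_continuous_def
  proof
    fix A assume A: "A \<in> null_sets \<pi>"
    then have [measurable]: "A \<in> sets \<pi>" "A \<in> sets \<rho>" using sets by auto
    have le: "t * measure \<rho> A \<le> C" if t: "0 \<le> t" for t
    proof -
      have "AE x in \<pi>. exp (t * indicator A x) = 1"
        using AE_not_in[OF A] by eventually_elim simp
      then have "(LINT x|\<pi>. exp (t * indicator A x)) = (LINT x|\<pi>. 1)"
        by (intro integral_cong_AE) auto
      moreover have "(LINT x|\<rho>. ln (exp (t * indicator A x))) \<le> ln (LINT x|\<pi>. exp (t * indicator A x)) + C"
        using t by (intro dual[where b="exp t"]) (auto simp: indicator_def)
      ultimately show ?thesis using \<pi>.prob_space by simp
    qed
    have "measure \<rho> A = 0"
    proof (rule ccontr)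
      assume "measure \<rho> A \<noteq> 0"
      then have pos: "0 < measure \<rho> A" by (simp add: less_le)
      have "0 \<le> C" using le[of 0] by simp
      then have "C + 1 \<le> C"
        using le[of "(C + 1) / measure \<rho> A"] pos by simp
      then show False by simp
    qed
    then show "A \<in> null_sets \<rho>"
      using \<rho>.emeasure_eq_measure by (intro null_setsI) auto
  qed
  define r where "r x = enn2real (RN_deriv \<pi> \<rho> x)" for x
  have [measurable]: "r \<in> borel_measurable \<pi>" unfolding r_def[abs_def] by measurable
  have r0: "0 \<le> r x" for x by (simp add: r_def)
  have "density \<pi> (\<lambda>x. ennreal (r x)) = density \<pi> (RN_deriv \<pi> \<rho>)"
    using \<pi>.RN_deriv_finite[OF \<rho>.sigma_finite_measure_axioms ac sets]
    by (intro density_cong) (auto simp: r_def less_top)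
  then have \<rho>: "\<rho> = density \<pi> (\<lambda>x. ennreal (r x))"
    using \<pi>.density_RN_deriv[OF ac sets] by simp
  have ent: "entropy_density (exp 1) \<pi> \<rho> = (\<lambda>x. ln (r x))"
    by (simp add: entropy_density_def comp_def r_def log_ln)
  have int_\<rho>: "(LINT x|\<rho>. g x) = (LINT x|\<pi>. r x * g x)"
    if [measurable]: "g \<in> borel_measurable \<pi>" for g :: "'a \<Rightarrow> real"
    unfolding \<rho> by (subst integral_density) (auto simp: r0)
  have intg_\<rho>: "integrable \<rho> g \<longleftrightarrow> integrable \<pi> (\<lambda>x. r x * g x)"
    if [measurable]: "g \<in> borel_measurable \<pi>" for g :: "'a \<Rightarrow> real"
    unfolding \<rho> by (subst integrable_density) (auto simp: r0)
  have r_int: "integrable \<pi> r" using intg_\<rho>[of "\<lambda>_. 1"] by simp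
  have r_one: "(LINT x|\<pi>. r x) = 1" using int_\<rho>[of "\<lambda>_. 1"] \<rho>.prob_space by simp
  have r_pos: "AE x in \<rho>. 0 < r x"
    by (subst \<rho>, subst AE_density) (auto simp: r0 less_le)
  define c where "c m x = max (1 / (real m + 1)) (min (r x) (real m + 1))" for m :: nat and x
  have [measurable]: "c m \<in> borel_measurable \<pi>" for m unfolding c_def[abs_def] by measurable
  have inv_le: "1 / (real m + 1) \<le> 1" "1 \<le> real m + 1" for m by auto
  have c_bounds: "1 / (real m + 1) \<le> c m x" "c m x \<le> real m + 1" for m x
    using order_trans[OF inv_le, of m] by (auto simp: c_def)
  have c_pos: "0 < c m x" for m x
    by (rule less_le_trans[OF _ c_bounds(1)]) simp
  have ln_c_bound: "\<bar>ln (c m x)\<bar> \<le> ln (real m + 1)" for m x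
  proof -
    have "ln (1 / (real m + 1)) \<le> ln (c m x)" using c_bounds(1)[of m x] by (intro ln_mono) auto
    moreover have "ln (c m x) \<le> ln (real m + 1)" using c_bounds(2)[of m x] c_pos by (intro ln_mono) auto
    ultimately show ?thesis by (simp add: ln_div)
  qed
  have int_ln_c: "integrable \<rho> (\<lambda>x. ln (c m x))" for m
    by (rule \<rho>.integrable_const_bound[where B="ln (real m + 1)"]) (auto simp: ln_c_bound)
  have c_le: "(LINT x|\<rho>. ln (c m x)) \<le> C + 1 / (real m + 1)" for m
  proof -
    let ?N = "real m + 1"
    have int_c: "integrable \<pi> (c m)"
      by (rule \<pi>.integrable_const_bound[where B="?N"]) (use c_bounds c_pos in \<open>auto simp: less_imp_le\<close>)
    let ?I = "LINT x|\<pi>. c m x"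
    have "1 / ?N \<le> ?I"
      using int_c c_bounds(1) by (intro \<pi>.integral_ge_const) auto
    then have I_pos: "0 < ?I" by (rule less_le_trans[rotated]) simp
    have "max a (min q b) \<le> q + a" if "0 \<le> a" "0 \<le> q" for a b q :: real
      using that by linarith
    then have "c m x \<le> r x + 1 / ?N" for x
      using r0 by (simp add: c_def)
    then have "?I \<le> (LINT x|\<pi>. r x + 1 / ?N)"
      using int_c r_int by (intro integral_mono Bochner_Integration.integrable_add) auto
    then have I_le: "?I \<le> 1 + 1 / ?N"
      using r_int r_one \<pi>.prob_space by simp
    have "(LINT x|\<rho>. ln (?N * c m x)) \<le> ln (LINT x|\<pi>. ?N * c m x) + C"
    proof (rule dual)
      show "1 \<le> ?N * c m x" for x using c_bounds(1)[of m x] by (simp add: field_simps)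
      show "?N * c m x \<le> ?N * ?N" for x using c_bounds(2)[of m x] by (intro mult_left_mono) auto
    qed simp
    also have "(LINT x|\<rho>. ln (?N * c m x)) = ln ?N + (LINT x|\<rho>. ln (c m x))"
      using c_pos int_ln_c[of m] \<rho>.prob_space by (simp add: ln_mult less_imp_neq[OF c_pos, symmetric])
    also have "(LINT x|\<pi>. ?N * c m x) = ?N * ?I" by simp
    also have "ln (?N * ?I) = ln ?N + ln ?I"
      using I_pos by (simp add: ln_mult)
    also have "ln ?I \<le> 1 / ?N"
      using ln_le_minus_one[OF I_pos] I_le by simp
    finally show ?thesis by simp
  qed
  define n where "n x = max 0 (- ln (r x))" for x
  define p where "p x = max 0 (ln (r x))" for x
  have [measurable]: "n \<in> borel_measurable \<pi>" "p \<in> borel_measurable \<pi>"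
    unfolding n_def[abs_def] p_def[abs_def] by measurable
  have int_n: "integrable \<rho> n"
  proof -
    have "\<bar>r x * n x\<bar> \<le> 1" for x
    proof (cases "r x > 0 \<and> n x > 0")
      case True
      then have "- ln (r x) = ln (1 / r x)" by (simp add: ln_div)
      also have "\<dots> \<le> 1 / r x" using ln_bound[of "1 / r x"] True by simp
      finally have "r x * n x \<le> r x * (1 / r x)"
        using True by (intro mult_left_mono) (auto simp: n_def)
      then show ?thesis using True by (simp add: abs_mult)
    next
      case False
      then have "r x = 0 \<or> n x = 0" using r0[of x] by (auto simp: n_def max_def split: if_splits)
      then show ?thesis by auto
    qed
    then have "integrable \<pi> (\<lambda>x. r x * n x)" by (intro \<pi>.integrable_const_bound[where B=1]) auto
    then show ?thesis by (simp add: intg_\<rho>)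
  qed
  have pm: "min (p x) (ln (real m + 1)) \<le> ln (c m x) + n x" and lc: "\<bar>ln (c m x)\<bar> \<le> \<bar>ln (r x)\<bar>"
    if r: "0 < r x" for m x
  proof -
    have "min (p x) (ln (real m + 1)) \<le> ln (c m x) + n x \<and> \<bar>ln (c m x)\<bar> \<le> \<bar>ln (r x)\<bar>"
    proof (cases "1 \<le> r x")
      case True
      have "max a (min q b) = min q b" if "a \<le> 1" "1 \<le> b" "1 \<le> q" for a b q :: real
        using that by linarith
      with True have "c m x = min (r x) (real m + 1)" using inv_le[of m] by (simp only: c_def)
      moreover have "0 \<le> ln (r x)" using True by simp
      moreover have "ln (min (r x) (real m + 1)) = min (ln (r x)) (ln (real m + 1))"
        using r by (auto simp: min_def)
      ultimately show ?thesis by (auto simp: p_def n_def)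
    next
      case False
      then have ln0: "ln (r x) < 0" using r by simp
      have "q \<le> max a (min q b) \<and> max a (min q b) \<le> 1" if "a \<le> 1" "1 \<le> b" "q < 1" for a b q :: real
        using that by linarith
      then have "r x \<le> c m x" "c m x \<le> 1" using False inv_le[of m] by (auto simp: c_def simp del: max_less_iff_conj)
      then have "ln (r x) \<le> ln (c m x)" "ln (c m x) \<le> 0" using r c_pos[of m x] by (auto intro: ln_mono)
      then show ?thesis using ln0 by (auto simp: p_def n_def)
    qed
    then show "min (p x) (ln (real m + 1)) \<le> ln (c m x) + n x" "\<bar>ln (c m x)\<bar> \<le> \<bar>ln (r x)\<bar>" by auto
  qed
  have int_p: "integrable \<rho> p"
  proof (rule integrableI_nonneg)
    let ?K = "ennreal (C + 1 + (LINT x|\<rho>. n x))"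
    have trunc: "(\<integral>\<^sup>+x. ennreal (min (p x) (ln (real m + 1))) \<partial>\<rho>) \<le> ?K" for m
    proof -
      have int_min: "integrable \<rho> (\<lambda>x. min (p x) (ln (real m + 1)))"
        by (rule \<rho>.integrable_const_bound[where B="ln (real m + 1)"]) (auto simp: p_def)
      have "(\<integral>\<^sup>+x. ennreal (min (p x) (ln (real m + 1))) \<partial>\<rho>) = ennreal (LINT x|\<rho>. min (p x) (ln (real m + 1)))"
        using int_min by (intro nn_integral_eq_integral) (auto simp: p_def)
      also have "\<dots> \<le> ennreal (LINT x|\<rho>. ln (c m x) + n x)"
        using int_min int_ln_c int_n r_pos pm
        by (intro ennreal_leI integral_mono_AE Bochner_Integration.integrable_add) (auto elim!: eventually_mono)
      also have "\<dots> \<le> ?K"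
        using order_trans[OF c_le[of m] add_left_mono[OF inv_le(1)]] int_ln_c[of m] int_n
        by (intro ennreal_leI) simp
      finally show ?thesis .
    qed
    have "(\<integral>\<^sup>+x. ennreal (p x) \<partial>\<rho>) \<le> (\<integral>\<^sup>+x. (SUP m. ennreal (min (p x) (ln (real m + 1)))) \<partial>\<rho>)"
    proof (rule nn_integral_mono)
      fix x
      obtain m where "exp (p x) \<le> real m" using real_arch_simple by blast
      then have "p x \<le> ln (real m + 1)" by (subst ln_ge_iff) auto
      then show "ennreal (p x) \<le> (SUP m. ennreal (min (p x) (ln (real m + 1))))"
        by (intro SUP_upper2[of m]) auto
    qed
    also have "\<dots> = (SUP m. \<integral>\<^sup>+x. ennreal (min (p x) (ln (real m + 1))) \<partial>\<rho>)"
      by (rule nn_integral_monotone_convergence_SUP)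
         (auto simp: incseq_def le_fun_def intro!: ennreal_leI min.mono ln_mono)
    also have "\<dots> \<le> ?K" using trunc by (intro SUP_least) auto
    also have "\<dots> < \<infinity>" by simp
    finally show "(\<integral>\<^sup>+x. ennreal (p x) \<partial>\<rho>) < \<infinity>" .
  qed (auto simp: p_def)
  have "(\<lambda>x. p x - n x) = (\<lambda>x. ln (r x))" by (auto simp: p_def n_def max_def)
  with int_p int_n have int_ln: "integrable \<rho> (\<lambda>x. ln (r x))"
    using Bochner_Integration.integrable_diff[of \<rho> p n] by simp
  have "(\<lambda>m. LINT x|\<rho>. ln (c m x)) \<longlonglongrightarrow> (LINT x|\<rho>. ln (r x))"
  proof (rule integral_dominated_convergence)
    show "integrable \<rho> (\<lambda>x. \<bar>ln (r x)\<bar>)" using int_ln by simp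
    show "AE x in \<rho>. (\<lambda>m. ln (c m x)) \<longlonglongrightarrow> ln (r x)"
      using r_pos
    proof (rule AE_mp, intro AE_I2 impI)
      fix x assume r: "0 < r x"
      obtain M where M: "max (r x) (1 / r x) \<le> real M" using real_arch_simple by blast
      have "c m x = r x" if "M \<le> m" for m
      proof -
        have "r x \<le> real m + 1" "1 / r x \<le> real m + 1" using M that by auto
        then have "1 / (real m + 1) \<le> r x" using r by (simp add: field_simps)
        with \<open>r x \<le> real m + 1\<close> show ?thesis by (simp add: c_def)
      qed
      then show "(\<lambda>m. ln (c m x)) \<longlonglongrightarrow> ln (r x)"
        by (intro tendsto_eventually eventually_sequentiallyI[of M]) simp
    qed
    show "AE x in \<rho>. norm (ln (c m x)) \<le> \<bar>ln (r x)\<bar>" for m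
      using r_pos lc by (auto elim!: eventually_mono)
  qed auto
  moreover have "(\<lambda>m. C + 1 / (real m + 1)) \<longlonglongrightarrow> C + 0"
    using LIMSEQ_inverse_real_of_nat by (intro tendsto_add tendsto_const) (simp add: inverse_eq_divide add.commute)
  ultimately have "(LINT x|\<rho>. ln (r x)) \<le> C"
    using c_le by (simp add: LIMSEQ_le)
  then show ?thesis
    using ac int_ln by (simp add: KL_def KL_divergence_def ent)
qed

section \<open>The law of the iterates and the convergence rate\<close>

context proximal_sampler
begin

lemma prob_space_G: "prob_space (G x)"
  unfolding G_eq using eta_pos by (rule prob_space_gaussian)

lemma prox_step:
  assumes \<mu>: "prob_space \<mu>" "sets \<mu> = sets borel"
  shows "prob_space ((\<mu> \<bind> G) \<bind> Q)" "sets ((\<mu> \<bind> G) \<bind> Q) = sets borel"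
    and "\<And>h. h \<in> borel_measurable borel \<Longrightarrow>
      (\<integral>\<^sup>+x. h x \<partial>((\<mu> \<bind> G) \<bind> Q)) = (\<integral>\<^sup>+x. \<integral>\<^sup>+y. \<integral>\<^sup>+z. h z \<partial>Q y \<partial>G x \<partial>\<mu>)"
    and "\<And>(g :: 'a \<Rightarrow> real) a b. g \<in> borel_measurable borel \<Longrightarrow> (\<And>x. a \<le> g x) \<Longrightarrow> (\<And>x. g x \<le> b) \<Longrightarrow>
      (LINT x|((\<mu> \<bind> G) \<bind> Q). g x) = (LINT x|\<mu>. P g x)"
proof -
  interpret \<mu>: prob_space \<mu> by fact
  note [measurable_cong] = \<mu>(2)
  have space: "space \<mu> = UNIV" using \<mu>(2) by (metis sets_eq_imp_space_eq space_borel)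
  have G [measurable]: "G \<in> \<mu> \<rightarrow>\<^sub>M subprob_algebra borel" by measurable
  have sG [measurable_cong]: "sets (\<mu> \<bind> G) = sets borel"
    by (rule sets_bind_measurable[OF G]) (simp add: space)
  have spG: "space (\<mu> \<bind> G) = UNIV" using sG by (metis sets_eq_imp_space_eq space_borel)
  have Q [measurable]: "Q \<in> (\<mu> \<bind> G) \<rightarrow>\<^sub>M subprob_algebra borel" by measurable
  have pG: "prob_space (\<mu> \<bind> G)"
    by (rule \<mu>.prob_space_bind[OF _ G]) (simp add: prob_space_G)
  then interpret \<mu>G: prob_space "\<mu> \<bind> G" .
  show "prob_space ((\<mu> \<bind> G) \<bind> Q)"
    by (rule \<mu>G.prob_space_bind[OF _ Q]) (simp add: prob_space_Q)
  show "sets ((\<mu> \<bind> G) \<bind> Q) = sets borel"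
    by (rule sets_bind_measurable[OF Q]) (simp add: spG)
  show "(\<integral>\<^sup>+x. h x \<partial>((\<mu> \<bind> G) \<bind> Q)) = (\<integral>\<^sup>+x. \<integral>\<^sup>+y. \<integral>\<^sup>+z. h z \<partial>Q y \<partial>G x \<partial>\<mu>)"
    if [measurable]: "h \<in> borel_measurable borel" for h :: "'a \<Rightarrow> ennreal"
  proof -
    have "(\<lambda>y. \<integral>\<^sup>+z. h z \<partial>Q y) \<in> borel_measurable borel"
      by (rule measurable_compose[OF measurable_Q nn_integral_measurable_subprob_algebra]) simp
    then show ?thesis
      by (simp add: nn_integral_bind[OF that Q] nn_integral_bind[OF _ G])
  qed
  show "(LINT x|((\<mu> \<bind> G) \<bind> Q). g x) = (LINT x|\<mu>. P g x)"
    if g: "g \<in> borel_measurable borel" "\<And>x. a \<le> g x" "\<And>x. g x \<le> b" for g :: "'a \<Rightarrow> real" and a b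
  proof -
    note q = integral_Q_bounds[OF g]
    have mass: "AE y in \<nu>. emeasure (K y) (space (K y)) \<le> ennreal 1" if "\<And>y. prob_space (K y)" for K :: "'a \<Rightarrow> 'a measure" and \<nu>
      using prob_space.emeasure_space_1[OF that] by simp
    have "(LINT x|((\<mu> \<bind> G) \<bind> Q). g x) = (LINT y|(\<mu> \<bind> G). LINT z|Q y. g z)"
      by (rule integral_bind[where K=borel and B="max \<bar>a\<bar> \<bar>b\<bar>", OF g(1) _ Q \<mu>G.finite_measure_axioms mass[OF prob_space_Q]])
         (use g in \<open>smt (verit)\<close>)
    also have "\<dots> = (LINT x|\<mu>. LINT y|G x. LINT z|Q y. g z)"
      by (rule integral_bind[where K=borel and B="max \<bar>a\<bar> \<bar>b\<bar>", OF q(1) _ G \<mu>.finite_measure_axioms mass[OF prob_space_G]])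
         (use q(2,3) in \<open>smt (verit)\<close>)
    finally show ?thesis by (simp add: P_def)
  qed
qed

lemma prox_law_space:
  assumes "prob_space \<mu>" "sets \<mu> = sets borel"
  shows "prob_space (prox_law f \<eta> \<mu> k)" "sets (prox_law f \<eta> \<mu> k) = sets borel"
  by (induction k) (use assms prox_step in auto)

lemma integral_prox_law:
  fixes g :: "'a \<Rightarrow> real"
  assumes \<mu>: "prob_space \<mu>" "sets \<mu> = sets borel"
    and g: "g \<in> borel_measurable borel" "\<And>x. a \<le> g x" "\<And>x. g x \<le> b"
  shows "(LINT x|prox_law f \<eta> \<mu> k. g x) = (LINT x|\<mu>. (P ^^ k) g x)"
  using g
proof (induction k arbitrary: g)
  case 0
  then show ?case by simp
next
  case (Suc k)
  have "(LINT x|prox_law f \<eta> \<mu> (Suc k). g x) = (LINT x|prox_law f \<eta> \<mu> k. P g x)"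
    using prox_step(4)[OF prox_law_space[OF \<mu>] Suc.prems] by simp
  also have "\<dots> = (LINT x|\<mu>. (P ^^ k) (P g) x)"
    by (rule Suc.IH) (rule P_bounds[OF Suc.prems])+
  finally show ?case by (simp add: funpow_swap1)
qed

lemma target_eq: "target f = density lborel (\<lambda>x. ennreal (exp (- f x) / (LINT z|lborel. exp (- f z))))"
  by (simp add: target_def normalized_measure_def)

lemma sets_target [simp, measurable_cong]: "sets (target f) = sets borel"
  and space_target [simp]: "space (target f) = UNIV"
  by (simp_all add: target_eq)

lemma normalization_pos: "0 < (LINT z|lborel. exp (- f z))"
  using integrable_exp_f by (rule lborel_integral_pos) simp

lemma prob_space_target: "prob_space (target f)"
proof
  have "emeasure (target f) (space (target f)) = (\<integral>\<^sup>+x. ennreal (exp (- f x) / (LINT z|lborel. exp (- f z))) \<partial>lborel)"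
    by (simp add: target_eq emeasure_density)
  also have "\<dots> = ennreal (LINT x|lborel. exp (- f x) / (LINT z|lborel. exp (- f z)))"
    using integrable_exp_f normalization_pos by (intro nn_integral_eq_integral) auto
  also have "\<dots> = 1" using normalization_pos by simp
  finally show "emeasure (target f) (space (target f)) = 1" .
qed

text \<open>The target is the \<open>x\<close>-marginal of the joint law with density proportional to \<open>w\<close>, whose \<open>y\<close>-marginal is
proportional to \<open>Z\<close>; resampling \<open>y\<close> and then \<open>x\<close> from the conditionals leaves the joint law unchanged.
Formally the two exchanges of integrals pass from the \<open>(x, y)\<close>-law to the \<open>(z, y)\<close>-law, which coincide.\<close>

lemma prox_step_target: "(target f \<bind> G) \<bind> Q = target f"
proof (rule measure_eqI)
  note step = prox_step[OF prob_space_target sets_target]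
  show "sets ((target f \<bind> G) \<bind> Q) = sets (target f)" using step(2) by simp
  fix A assume "A \<in> sets ((target f \<bind> G) \<bind> Q)"
  then have A [measurable]: "A \<in> sets borel" using step(2) by simp
  define C where "C = sqrt (2 * pi * \<eta>) ^ DIM('a)"
  define Z0 where "Z0 = (LINT z|lborel. exp (- f z))"
  have C: "0 < C" using eta_pos by (simp add: C_def)
  have Z0: "0 < Z0" using normalization_pos by (simp add: Z0_def)
  define q where "q y = (\<integral>\<^sup>+z. indicator A z \<partial>Q y)" for y
  have [measurable]: "q \<in> borel_measurable borel"
    unfolding q_def by (rule measurable_compose[OF measurable_Q nn_integral_measurable_subprob_algebra]) simp
  have joint: "ennreal (exp (- f x) / Z0) * ennreal (gaussian_density \<eta> x y) = ennreal (w x y / (C * Z0))" for x y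
  proof -
    have "exp (- f x) * exp (- (norm (y - x))\<^sup>2 / (2 * \<eta>)) = w x y"
      by (simp add: joint_weight_def norm_minus_commute flip: exp_add)
    then have "(exp (- f x) / Z0) * gaussian_density \<eta> x y = w x y / (C * Z0)"
      by (simp add: gaussian_density_def C_def mult.commute)
    then show ?thesis
      using Z0 by (subst ennreal_mult'[symmetric]) auto
  qed
  have "emeasure ((target f \<bind> G) \<bind> Q) A = (\<integral>\<^sup>+x. indicator A x \<partial>((target f \<bind> G) \<bind> Q))"
    using step(2) by simp
  also have "\<dots> = (\<integral>\<^sup>+x. \<integral>\<^sup>+y. q y \<partial>G x \<partial>target f)"
    unfolding q_def by (rule step(3)) simp
  also have "\<dots> = (\<integral>\<^sup>+x. ennreal (exp (- f x) / Z0) * (\<integral>\<^sup>+y. ennreal (gaussian_density \<eta> x y) * q y \<partial>lborel) \<partial>lborel)"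
    unfolding target_eq G_eq gaussian_eq Z0_def[symmetric]
    by (simp add: nn_integral_density)
  also have "\<dots> = (\<integral>\<^sup>+x. \<integral>\<^sup>+y. ennreal (w x y / (C * Z0)) * q y \<partial>lborel \<partial>lborel)"
    by (simp add: nn_integral_cmult[symmetric] mult.assoc[symmetric] joint)
  also have "\<dots> = (\<integral>\<^sup>+y. \<integral>\<^sup>+x. ennreal (w x y / (C * Z0)) * q y \<partial>lborel \<partial>lborel)"
    by (rule lborel_pair.Fubini') measurable
  also have "\<dots> = (\<integral>\<^sup>+y. ennreal (Z y / (C * Z0)) * q y \<partial>lborel)"
  proof (intro nn_integral_cong)
    fix y
    have "(\<integral>\<^sup>+x. ennreal (w x y / (C * Z0)) \<partial>lborel) = ennreal (LINT x|lborel. w x y / (C * Z0))"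
      using integrable_w[of y] w_pos[THEN less_imp_le] C Z0 by (intro nn_integral_eq_integral) auto
    then show "(\<integral>\<^sup>+x. ennreal (w x y / (C * Z0)) * q y \<partial>lborel) = ennreal (Z y / (C * Z0)) * q y"
      by (simp add: nn_integral_multc Z_def)
  qed
  also have "\<dots> = (\<integral>\<^sup>+y. \<integral>\<^sup>+z. ennreal (w z y / (C * Z0)) * indicator A z \<partial>lborel \<partial>lborel)"
  proof (intro nn_integral_cong)
    fix y
    have "ennreal (Z y / (C * Z0)) * q y = (\<integral>\<^sup>+z. ennreal (Z y / (C * Z0)) * (ennreal (w z y / Z y) * indicator A z) \<partial>lborel)"
      unfolding q_def Q_eq by (subst nn_integral_density) (auto simp: nn_integral_cmult)
    also have "\<dots> = (\<integral>\<^sup>+z. ennreal (w z y / (C * Z0)) * indicator A z \<partial>lborel)"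
      using Z_pos[of y] C Z0
      by (simp add: mult.assoc[symmetric] flip: ennreal_mult')
    finally show "ennreal (Z y / (C * Z0)) * q y = (\<integral>\<^sup>+z. ennreal (w z y / (C * Z0)) * indicator A z \<partial>lborel)" .
  qed
  also have "\<dots> = (\<integral>\<^sup>+z. \<integral>\<^sup>+y. ennreal (w z y / (C * Z0)) * indicator A z \<partial>lborel \<partial>lborel)"
    by (rule lborel_pair.Fubini') measurable
  also have "\<dots> = (\<integral>\<^sup>+z. ennreal (exp (- f z) / Z0) * indicator A z \<partial>lborel)"
    using eta_pos
    by (simp add: joint[symmetric] nn_integral_multc nn_integral_cmult nn_integral_gaussian_density)
  also have "\<dots> = emeasure (target f) A"
    unfolding target_eq Z0_def by (simp add: emeasure_density)
  finally show "emeasure ((target f \<bind> G) \<bind> Q) A = emeasure (target f) A" .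
qed

lemma prox_law_target: "prox_law f \<eta> (target f) k = target f"
  by (induction k) (simp_all add: prox_step_target)

text \<open>The log-Harnack inequality is integrated against the coupling. On the side of the target, Jensen's
inequality moves the logarithm out of the integral and stationarity removes the iterated operator.\<close>

lemma KL_prox_law_le_coupling_cost:
  assumes \<mu>: "prob_space \<mu>" "sets \<mu> = sets borel"
    and \<gamma>: "\<gamma> \<in> couplings \<mu> (target f)"
    and cost: "(\<integral>\<^sup>+(x, y). ennreal ((norm (x - y))\<^sup>2) \<partial>\<gamma>) = ennreal c" "0 \<le> c"
  shows "KL (target f) (prox_law f \<eta> \<mu> (Suc m)) \<le> ereal (c / (2 * (real m + 1) * \<eta>))"
proof (rule KL_le_of_dual_bound[OF prob_space_target prox_law_space(1)[OF \<mu>]])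
  show "sets (prox_law f \<eta> \<mu> (Suc m)) = sets (target f)"
    using prox_law_space(2)[OF \<mu>, of "Suc m"] by (simp only: sets_target)
  interpret \<pi>: prob_space "target f" by (rule prob_space_target)
  interpret \<mu>: prob_space \<mu> by fact
  have sets_\<gamma> [measurable_cong]: "sets \<gamma> = sets (borel \<Otimes>\<^sub>M borel)"
    and fst_\<gamma>: "distr \<gamma> borel fst = \<mu>" and snd_\<gamma>: "distr \<gamma> borel snd = target f"
    using \<gamma> by (auto simp: couplings_def)
  have [measurable]: "fst \<in> \<gamma> \<rightarrow>\<^sub>M borel" "snd \<in> \<gamma> \<rightarrow>\<^sub>M borel" by measurable
  interpret \<gamma>: prob_space \<gamma>
    by (rule prob_space_distrD[of fst \<gamma> borel]) (simp_all add: fst_\<gamma> \<mu>)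
  have int_cost: "integrable \<gamma> (\<lambda>p. (norm (fst p - snd p))\<^sup>2)"
    and cost_eq: "(LINT p|\<gamma>. (norm (fst p - snd p))\<^sup>2) = c"
    using cost by (auto intro!: integrableI_nonneg simp: split_beta' integral_eq_nn_integral)
  let ?\<kappa> = "2 * (real m + 1) * \<eta>"
  fix g :: "'a \<Rightarrow> real" and b
  assume "g \<in> borel_measurable (target f)" and g1: "\<And>x. 1 \<le> g x" and gb: "\<And>x. g x \<le> b"
  then have g [measurable]: "g \<in> borel_measurable borel" by simp
  have pos: "0 < g x" for x using g1[of x] by simp
  have ln_g: "(\<lambda>x. ln (g x)) \<in> borel_measurable borel" "\<And>x. 0 \<le> ln (g x)" "\<And>x. ln (g x) \<le> ln b"
    using g1 gb pos by (auto intro!: ln_mono)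
  let ?\<phi> = "(P ^^ Suc m) (\<lambda>x. ln (g x))" and ?\<psi> = "(P ^^ Suc m) g"
  have \<phi>: "?\<phi> \<in> borel_measurable borel" "\<And>x. 0 \<le> ?\<phi> x" "\<And>x. ?\<phi> x \<le> ln b"
    using P_funpow_bounds[OF ln_g, of "Suc m"] by auto
  have \<psi>: "?\<psi> \<in> borel_measurable borel" "\<And>x. 1 \<le> ?\<psi> x" "\<And>x. ?\<psi> x \<le> b"
    using P_funpow_bounds[OF g g1 gb, of "Suc m"] by auto
  have \<psi>pos: "0 < ?\<psi> x" for x using \<psi>(2)[of x] by linarith
  note [measurable] = \<phi>(1) \<psi>(1)
  have "integrable \<gamma> (\<lambda>p. ?\<phi> (fst p))"
    by (rule \<gamma>.integrable_const_bound[where B="ln b"]) (use \<phi> in auto)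
  moreover have int\<psi>: "integrable \<gamma> (\<lambda>p. ln (?\<psi> (snd p)))"
    by (rule \<gamma>.integrable_const_bound[where B="ln b"]) (use \<psi> \<psi>pos in \<open>auto intro!: ln_mono\<close>)
  ultimately have "(LINT p|\<gamma>. ?\<phi> (fst p)) \<le> (LINT p|\<gamma>. ln (?\<psi> (snd p)) + (norm (fst p - snd p))\<^sup>2 / ?\<kappa>)"
    using int_cost log_harnack[OF g g1 gb, of m]
    by (intro integral_mono Bochner_Integration.integrable_add integrable_divide) auto
  also have "\<dots> = (LINT p|\<gamma>. ln (?\<psi> (snd p))) + c / ?\<kappa>"
    using int\<psi> int_cost cost_eq by simp
  also have "(LINT p|\<gamma>. ln (?\<psi> (snd p))) = (LINT x|target f. ln (?\<psi> x))"
    unfolding snd_\<gamma>[symmetric]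
    by (rule integral_distr[OF _ borel_measurable_ln[OF \<psi>(1)], symmetric]) simp
  also have "\<dots> \<le> ln (LINT x|target f. ?\<psi> x)"
    using \<psi> by (intro \<pi>.expectation_ln_le) auto
  also have "(LINT x|target f. ?\<psi> x) = (LINT x|target f. g x)"
    using integral_prox_law[OF prob_space_target sets_target g g1 gb, of "Suc m"]
    by (simp only: prox_law_target)
  also have "(LINT p|\<gamma>. ?\<phi> (fst p)) = (LINT x|\<mu>. ?\<phi> x)"
    unfolding fst_\<gamma>[symmetric] by (rule integral_distr[OF _ \<phi>(1), symmetric]) simp
  also have "\<dots> = (LINT x|prox_law f \<eta> \<mu> (Suc m). ln (g x))"
    by (rule integral_prox_law[OF \<mu> ln_g, symmetric])
  finally show "(LINT x|prox_law f \<eta> \<mu> (Suc m). ln (g x)) \<le> ln (LINT x|target f. g x) + c / ?\<kappa>"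
    by simp
qed

end

text \<open>Only couplings of finite cost matter for the infimum. The factor 2 gained by the log-Harnack inequality
is given away at the end.\<close>

theorem theorem2:
  fixes f :: "'a::euclidean_space \<Rightarrow> real"
    and \<eta> :: real
    and \<rho>0 :: "'a measure"
    and k :: nat
  assumes "convex_on UNIV f"
    and "integrable lborel (\<lambda>x. exp (- f x))"
    and "integrable (target f) (\<lambda>x. (norm x)\<^sup>2)"
    and "\<eta> > 0"
    and "prob_space \<rho>0"
    and "sets \<rho>0 = sets borel"
    and "k \<ge> 1"
  shows "KL (target f) (prox_law f \<eta> \<rho>0 k)
           \<le> enn2ereal (W2_sq \<rho>0 (target f)) / ereal (real k * \<eta>)"
proof -
  interpret proximal_sampler f \<eta>
    using assms by unfold_locales auto
  obtain m where k: "k = Suc m" using \<open>k \<ge> 1\<close> by (cases k) auto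
  let ?K = "KL (target f) (prox_law f \<eta> \<rho>0 k)" and ?\<kappa> = "real k * \<eta>"
  have \<kappa>: "0 < ?\<kappa>" using assms k by simp
  have "e2ennreal (?K * ereal ?\<kappa>) \<le> W2_sq \<rho>0 (target f)"
    unfolding W2_sq_def
  proof (rule INF_greatest)
    fix \<gamma> assume \<gamma>: "\<gamma> \<in> couplings \<rho>0 (target f)"
    show "e2ennreal (?K * ereal ?\<kappa>) \<le> (\<integral>\<^sup>+(x, y). ennreal ((norm (x - y))\<^sup>2) \<partial>\<gamma>)"
    proof (cases "\<integral>\<^sup>+(x, y). ennreal ((norm (x - y))\<^sup>2) \<partial>\<gamma>")
      case (real c)
      have "?K \<le> ereal (c / (2 * (real m + 1) * \<eta>))"
        unfolding k using assms(5,6) \<gamma> real by (intro KL_prox_law_le_coupling_cost) auto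
      also have "c / (2 * (real m + 1) * \<eta>) \<le> c / ?\<kappa>"
        using real \<kappa> eta_pos k by (intro divide_left_mono) auto
      finally have "?K * ereal ?\<kappa> \<le> ereal (c / ?\<kappa>) * ereal ?\<kappa>"
        using \<kappa> by (intro ereal_mult_right_mono) auto
      also have "\<dots> = ereal c"
      proof -
        have "c / q * q = c" if "0 < q" for q using that by simp
        from this[OF \<kappa>] show ?thesis by (simp only: times_ereal.simps)
      qed
      finally have "e2ennreal (?K * ereal ?\<kappa>) \<le> e2ennreal (ereal c)"
        by (rule e2ennreal_mono)
      then show ?thesis using real by simp
    qed simp
  qed
  then have "enn2ereal (e2ennreal (?K * ereal ?\<kappa>)) \<le> enn2ereal (W2_sq \<rho>0 (target f))"
    by (simp add: less_eq_ennreal.rep_eq)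
  moreover have "r \<le> enn2ereal (e2ennreal r)" for r
    by (cases "0 \<le> r") (auto simp: enn2ereal_e2ennreal intro: order_trans[OF _ enn2ereal_nonneg])
  ultimately have "?K * ereal ?\<kappa> \<le> enn2ereal (W2_sq \<rho>0 (target f))"
    using order_trans by blast
  then show ?thesis
    using \<kappa> by (subst ereal_le_divide_pos) (auto simp: mult.commute)
qed

end
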